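(* Fix $t\in(0,1)$. Consider any sequence $s_n\to\infty$ (of positive integers) such that $s_n/n\to 0$, and any sequence $v_n\to\infty$. Let $\varphi^{\mathrm{C}\ell}$ be the cumulative $\ell$-value procedure at level $t$. Then, as $n\to\infty$, $$\sup_{\theta_0\in \ell_0(s_n;v_n)}\bigl|\mathrm{FDR}(\varphi^{\mathrm{C}\ell};\theta_0)-t\bigr|\to 0,\qquad \sup_{\theta_0\in \ell_0(s_n;v_n)}\mathrm{FNR}(\varphi^{\mathrm{C}\ell};\theta_0)\to 0.$$
   Context: Model: for each $n$ one observes $X=(X_1,\dots,X_n)$ with $X_i=\theta_{0,i}+\varepsilon_i$, $\varepsilon_i$ iid $\mathcal N(0,1)$, $\theta_0\in\mathbb R^n$ deterministic; $P_{\theta_0},E_{\theta_0}$ denote the law of $X$ and its expectation. Signal class: with $S_0=\{i:\theta_{0,i}\ne0\}$, $$\ell_0(s_n;v_n)=\{\theta_0\in\mathbb R^n: |S_0|=s_n,\ |\theta_{0,i}|\ge\sqrt{2\log(n/s_n)}+v_n\ \text{for all } i\in S_0\}.$$ Error rates: for a procedure $\varphi=\varphi(X)\in\{0,1\}^n$, $$\mathrm{FDP}(\varphi;\theta_0)=\frac{\sum_{i=1}^n \mathbf 1\{\theta_{0,i}=0,\varphi_i=1\}}{1\vee\sum_{i=1}^n\varphi_i},\quad \mathrm{FDR}(\varphi;\theta_0)=E_{\theta_0}[\mathrm{FDP}(\varphi;\theta_0)],$$ $$\mathrm{FNR}(\varphi;\theta_0)=E_{\theta_0}\Bigl[\frac{\sum_{i=1}^n\mathbf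 1\{\theta_{0,i}\neq0,\varphi_i=0\}}{1\vee\sum_{i=1}^n\mathbf 1\{\theta_{0,i}\ne0\}}\Bigr].$$ Procedure: let $\phi$ be the standard normal density and $g(x)=(2\pi)^{-1/2}x^{-2}(1-e^{-x^2/2})$ (extended continuously at $0$). For $w\in[0,1]$ the $\ell$-values are $$\ell_{i,w}(X)=\frac{(1-w)\phi(X_i)}{(1-w)\phi(X_i)+wg(X_i)}.$$ Let $\hat w=\operatorname{argmax}_{w\in[1/n,1]}\sum_{i=1}^n\log\bigl((1-w)\phi(X_i)+wg(X_i)\bigr)$ (which exists almost surely), and $$\hat\lambda=\sup\Bigl\{\lambda\in[0,1]:\frac{\sum_{i=1}^n\ell_{i,\hat w}(X)\mathbf 1\{\ell_{i,\hat w}(X)<\lambda\}}{1\vee\sum_{i=1}^n\mathbf 1\{\ell_{i,\hat w}(X)<\lambda\}}\le t\Bigr\}.$$ The cumulative $\ell$-value procedure at level $t$ is $\varphi^{\mathrm{C}\ell}=(\mathbf 1\{\ell_{i,\hat w}(X)<\hat\lambda\})_{1\le i\le n}$. *)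

theory Defs
  imports "HOL-Probability.Probability" "HOL-Real_Asymp.Real_Asymp"
begin

text \<open>
  Vectors of length \<open>n\<close> are functions \<open>nat \<Rightarrow> real\<close> that are extensional on the index
  set \<open>{1..n}\<close>, as in the carrier of a finite product measure. A procedure maps an observation
  to its \<open>n\<close> decisions, where \<open>True\<close> (a rejection) stands for 1 and \<open>False\<close> for 0.
\<close>

type_synonym procedure = "(nat \<Rightarrow> real) \<Rightarrow> nat \<Rightarrow> bool"

definition noise :: "nat \<Rightarrow> (nat \<Rightarrow> real) measure" where
  "noise n = (\<Pi>\<^sub>M i\<in>{1..n}. density lborel std_normal_density)"

definition law :: "nat \<Rightarrow> (nat \<Rightarrow> real) \<Rightarrow> (nat \<Rightarrow> real) measure" where
  "law n \<theta> = distr (noise n) (\<Pi>\<^sub>M i\<in>{1..n}. borel) (\<lambda>\<epsilon>. \<lambda>i\<in>{1..n}. \<theta> i + \<epsilon> i)"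

definition signal_class :: "nat \<Rightarrow> nat \<Rightarrow> real \<Rightarrow> (nat \<Rightarrow> real) set" where
  "signal_class n s v =
     {\<theta> \<in> {1..n} \<rightarrow>\<^sub>E UNIV.
        card {i\<in>{1..n}. \<theta> i \<noteq> 0} = s \<and>
        (\<forall>i\<in>{1..n}. \<theta> i \<noteq> 0 \<longrightarrow> \<bar>\<theta> i\<bar> \<ge> sqrt (2 * ln (real n / real s)) + v)}"

definition FDP :: "nat \<Rightarrow> (nat \<Rightarrow> bool) \<Rightarrow> (nat \<Rightarrow> real) \<Rightarrow> real" where
  "FDP n d \<theta> =
     (\<Sum>i\<in>{1..n}. of_bool (\<theta> i = 0 \<and> d i)) / max 1 (\<Sum>i\<in>{1..n}. of_bool (d i))"

definition FDR :: "nat \<Rightarrow> procedure \<Rightarrow> (nat \<Rightarrow> real) \<Rightarrow> real" where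
  "FDR n \<phi> \<theta> = (LINT X|law n \<theta>. FDP n (\<phi> X) \<theta>)"

definition FNR :: "nat \<Rightarrow> procedure \<Rightarrow> (nat \<Rightarrow> real) \<Rightarrow> real" where
  "FNR n \<phi> \<theta> =
     (LINT X|law n \<theta>.
        (\<Sum>i\<in>{1..n}. of_bool (\<theta> i \<noteq> 0 \<and> \<not> \<phi> X i)) /
        max 1 (\<Sum>i\<in>{1..n}. of_bool (\<theta> i \<noteq> 0)))"

definition slab_marginal :: "real \<Rightarrow> real" where
  "slab_marginal x = (if x = 0 then 1 / (2 * sqrt (2 * pi))
          else 1 / sqrt (2 * pi) * (1 - exp (- x\<^sup>2 / 2)) / x\<^sup>2)"

lemma isCont_slab_marginal_0: "isCont slab_marginal 0"
proof -
  have "((\<lambda>x::real. (1 - exp (- x\<^sup>2 / 2)) / x\<^sup>2) \<longlongrightarrow> 1 / 2) (at 0)"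
    by real_asymp
  from tendsto_mult_left[OF this, of "1 / sqrt (2 * pi)"]
  have "((\<lambda>x::real. 1 / sqrt (2 * pi) * (1 - exp (- x\<^sup>2 / 2)) / x\<^sup>2)
          \<longlongrightarrow> 1 / (2 * sqrt (2 * pi))) (at 0)"
    by (simp add: mult.commute)
  then have "(slab_marginal \<longlongrightarrow> 1 / (2 * sqrt (2 * pi))) (at 0)"
    by (rule Lim_transform_eventually) (auto simp: eventually_at_filter slab_marginal_def)
  then show ?thesis
    by (simp add: isCont_def slab_marginal_def)
qed

definition ell_value :: "real \<Rightarrow> real \<Rightarrow> real" where
  "ell_value w x =
     (1 - w) * std_normal_density x / ((1 - w) * std_normal_density x + w * slab_marginal x)"

definition log_marginal :: "nat \<Rightarrow> (nat \<Rightarrow> real) \<Rightarrow> real \<Rightarrow> real" where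
  "log_marginal n X w = (\<Sum>i\<in>{1..n}. ln ((1 - w) * std_normal_density (X i) + w * slab_marginal (X i)))"

text \<open>
  For \<open>n \<ge> 1\<close> the maximizer always exists, and it is unique unless \<open>n \<ge> 2\<close> and every
  \<open>X i\<close> is one of the two solutions of \<open>std_normal_density x = slab_marginal x\<close>. At these finitely many
  \<open>X\<close> the operator \<open>arg_max_on\<close> returns an arbitrary maximizer.
\<close>

definition w_hat :: "nat \<Rightarrow> (nat \<Rightarrow> real) \<Rightarrow> real" where
  "w_hat n X = arg_max_on (log_marginal n X) {1 / real n..1}"

definition lambda_hat :: "nat \<Rightarrow> real \<Rightarrow> (nat \<Rightarrow> real) \<Rightarrow> real" where
  "lambda_hat n t X =
     Sup {u\<in>{0..1}.
       (\<Sum>i\<in>{1..n}. ell_value (w_hat n X) (X i) * of_bool (ell_value (w_hat n X) (X i) < u)) /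
       max 1 (\<Sum>i\<in>{1..n}. of_bool (ell_value (w_hat n X) (X i) < u)) \<le> t}"

definition cumulative_ell :: "nat \<Rightarrow> real \<Rightarrow> procedure" where
  "cumulative_ell n t = (\<lambda>X i. ell_value (w_hat n X) (X i) < lambda_hat n t X)"

end

(* Write rho = g/phi and zeta = sqrt (2 log (n/s)). Since |X_i| > zeta + v/2 for most signals, their
likelihood ratios are of larger order than n/s, and the score of the marginal likelihood is positive
at s/(4n), even if every null contributes its worst value: so w_hat >= s/(4n), and most signals have
l-values close to 0. Conversely, E[(rho(X) - 1) 1{|X| <= zeta}] = -2 zeta g(zeta), of order -1/zeta,
under the null, so by Chebyshev the score at 4 (s/n) zeta is negative with high probability and
w_hat <= 4 (s/n) zeta. This bound is crude but suffices to make the l-values of all |x| <= zeta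
close to 1, while only o(s) nulls exceed zeta.

Rejections are the largest |X_i|. Take thresholds z1 and z2 that about c1 s and c2 s nulls exceed, with
c1 < t/(1-t) < c2 both close to t/(1-t). As null l-values are at most 1 and those of most exceeding
nulls are almost 1, the average l-value over {|X_i| > z1} is below t and the one over {|X_i| > z2} is
above t. The rejected set thus lies between these two sets; it contains almost all s signals and about
s t/(1-t) nulls, so its false discovery proportion is close to t. *)

theory Submission
  imports Defs
begin

section \<open>The likelihood ratio and normal tails\<close>

text \<open>The obstacle is that the weight and the rejection threshold both depend on the whole
  sample. Each is compared with deterministic points. Concavity of the log-likelihood turns the sign
  of the score at one fixed weight into a bound on \<open>w_hat\<close>. Removing the largest
  l-values from a set keeps an average that is at most t below t, which compares the rejected set
  with the sets above two fixed thresholds. So only five sums of functions of independent noise have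
  to concentrate, and Chebyshev's inequality handles each of them. The resulting failure probability
  is bounded through n and s alone, which makes the limits uniform over the signal class. The factor
  zeta in the upper weight comes from a balance: the nulls push the score down only by order n/zeta,
  while s signals may push it up by s/w. The factor is harmless because rho(zeta) is about
  (n/s)/zeta^2, so that the weight times rho(zeta) is still of order 1/zeta.\<close>

definition likelihood_ratio :: "real \<Rightarrow> real" where
  "likelihood_ratio x = slab_marginal x / std_normal_density x"

lemma likelihood_ratio_0 [simp]: "likelihood_ratio 0 = 1 / 2"
  by (simp add: likelihood_ratio_def slab_marginal_def std_normal_density_def)

lemma likelihood_ratio_eq:
  assumes "x \<noteq> 0"
  shows "likelihood_ratio x = (exp (x\<^sup>2 / 2) - 1) / x\<^sup>2"
proof -
  have "exp (x\<^sup>2 / 2) * exp (- x\<^sup>2 / 2) = 1"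
    by (simp flip: exp_add)
  then show ?thesis
    using assms by (simp add: likelihood_ratio_def slab_marginal_def std_normal_density_def field_simps)
qed

lemma likelihood_ratio_abs: "likelihood_ratio \<bar>x\<bar> = likelihood_ratio x"
  by (cases "x = 0") (simp_all add: likelihood_ratio_eq)

lemma std_normal_density_times_likelihood_ratio:
  "std_normal_density x * likelihood_ratio x = slab_marginal x"
  by (simp add: likelihood_ratio_def std_normal_density_def)

lemma likelihood_ratio_ge_half: "1 / 2 \<le> likelihood_ratio x"
proof (cases "x = 0")
  case False
  have "1 + x\<^sup>2 / 2 \<le> exp (x\<^sup>2 / 2)"
    by (rule exp_ge_add_one_self)
  then show ?thesis
    using False by (simp add: likelihood_ratio_eq field_simps)
qed simp

lemma likelihood_ratio_pos: "0 < likelihood_ratio x"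
  using likelihood_ratio_ge_half[of x] by linarith

text \<open>Convexity: these are secant slopes of exp from 0. With d = b - a the claim becomes d
  (e^a - 1) < a e^a (e^d - 1), which follows from e^a - 1 <= a e^a and d < e^d - 1.\<close>

lemma exp_minus_one_div_strict_mono:
  fixes a b :: real
  assumes "0 < a" "a < b"
  shows "(exp a - 1) / a < (exp b - 1) / b"
proof -
  define d where "d = b - a"
  have d: "0 < d" "b = a + d"
    using assms by (auto simp: d_def)
  have "exp a - 1 \<le> a * exp a"
    using exp_ge_add_one_self[of "- a"] mult_left_mono[of "1 - a" "exp (- a)" "exp a"]
    by (simp add: algebra_simps flip: exp_add)
  then have "d * (exp a - 1) \<le> d * (a * exp a)"
    using d by (intro mult_left_mono) auto
  also have "\<dots> = (a * exp a) * d"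
    by simp
  also have "\<dots> < (a * exp a) * (exp d - 1)"
    using assms d exp_minus_greater[of "- d"]
    by (intro mult_strict_left_mono) auto
  finally have "b * (exp a - 1) < a * (exp b - 1)"
    by (simp add: d exp_add algebra_simps)
  then show ?thesis
    using assms by (simp add: field_simps)
qed

lemma likelihood_ratio_strict_mono:
  assumes "\<bar>x\<bar> < \<bar>y\<bar>"
  shows "likelihood_ratio x < likelihood_ratio y"
proof -
  have y: "y \<noteq> 0"
    using assms by auto
  show ?thesis
  proof (cases "x = 0")
    case True
    \<comment> \<open>Strictness at 0: the weak bound 1 + z <= exp z at half the exponent, once
      squared, leaves the surplus (y^2/4)^2.\<close>
    have "0 < (y\<^sup>2 / 4)\<^sup>2"
      using y by simp
    then have "1 + y\<^sup>2 / 2 < (1 + y\<^sup>2 / 4)\<^sup>2"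
      by (simp add: power2_sum)
    also have "\<dots> \<le> (exp (y\<^sup>2 / 4))\<^sup>2"
      by (intro power_mono exp_ge_add_one_self) auto
    also have "\<dots> = exp (y\<^sup>2 / 2)"
      by (simp add: power2_eq_square flip: exp_add)
    finally have "1 + y\<^sup>2 / 2 < exp (y\<^sup>2 / 2)" .
    then show ?thesis
      using True y by (simp add: likelihood_ratio_eq field_simps)
  next
    case False
    have "x\<^sup>2 < y\<^sup>2"
      using assms by (metis abs_le_square_iff not_le)
    then have "(exp (x\<^sup>2/2) - 1) / (x\<^sup>2/2) < (exp (y\<^sup>2/2) - 1) / (y\<^sup>2/2)"
      using False by (intro exp_minus_one_div_strict_mono) auto
    then have "2 * ((exp (x\<^sup>2/2) - 1) / x\<^sup>2) < 2 * ((exp (y\<^sup>2/2) - 1) / y\<^sup>2)"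
      by (simp add: field_simps)
    then show ?thesis
      using False y by (simp add: likelihood_ratio_eq del: times_divide_eq_right)
  qed
qed

lemma likelihood_ratio_mono:
  assumes "\<bar>x\<bar> \<le> \<bar>y\<bar>"
  shows "likelihood_ratio x \<le> likelihood_ratio y"
  using assms likelihood_ratio_strict_mono[of x y] likelihood_ratio_abs[of x] likelihood_ratio_abs[of y]
  by (cases "\<bar>x\<bar> = \<bar>y\<bar>") auto

section \<open>Continuity, and an antiderivative for the truncated null mean\<close>

lemma isCont_slab_marginal: "isCont slab_marginal x"
proof (cases "x = 0")
  case True
  then show ?thesis
    using isCont_slab_marginal_0 by simp
next
  case False
  have "isCont (\<lambda>x. 1 / sqrt (2 * pi) * (1 - exp (- x\<^sup>2 / 2)) / x\<^sup>2) x"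
    using False by (intro continuous_intros) auto
  moreover have "eventually (\<lambda>y. y \<noteq> 0) (nhds x)"
    using False by (rule t1_space_nhds)
  then have "eventually (\<lambda>y. slab_marginal y = 1 / sqrt (2 * pi) * (1 - exp (- y\<^sup>2 / 2)) / y\<^sup>2) (nhds x)"
    by eventually_elim (simp add: slab_marginal_def)
  ultimately show ?thesis
    by (subst isCont_cong) auto
qed

lemma slab_marginal_measurable [measurable]: "slab_marginal \<in> borel_measurable borel"
  by (intro borel_measurable_continuous_onI continuous_at_imp_continuous_on ballI isCont_slab_marginal)

lemma likelihood_ratio_measurable [measurable]: "likelihood_ratio \<in> borel_measurable borel"
  unfolding likelihood_ratio_def[abs_def] by measurable

lemma has_field_derivative_times_slab_marginal:
  "((\<lambda>x. x * slab_marginal x) has_field_derivative std_normal_density x - slab_marginal x) (at x)"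
proof (cases "x = 0")
  case True
  \<comment> \<open>At 0 the difference quotient of the product is \<open>slab_marginal\<close>
    itself, so Caratheodory's criterion reduces differentiability to continuity.\<close>
  have "((\<lambda>x. x * slab_marginal x) has_field_derivative slab_marginal 0) (at 0)"
    using isCont_slab_marginal_0 by (subst CARAT_DERIV) (auto intro!: exI[of _ slab_marginal])
  moreover have "slab_marginal 0 = std_normal_density 0 - slab_marginal 0"
    by (simp add: slab_marginal_def std_normal_density_def)
  ultimately show ?thesis
    unfolding True by (rule DERIV_cong)
next
  case False
  define c where "c = sqrt (2 * pi)"
  have "c \<noteq> 0"
    by (simp add: c_def)
  then have "((\<lambda>x. 1 / c * (1 - exp (- x\<^sup>2 / 2)) / x) has_field_derivative
      1 / c * exp (- x\<^sup>2 / 2) - 1 / c * (1 - exp (- x\<^sup>2 / 2)) / x\<^sup>2) (at x)"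
    using False by (auto intro!: derivative_eq_intros simp: field_simps power2_eq_square)
  then have "((\<lambda>x. 1 / sqrt (2 * pi) * (1 - exp (- x\<^sup>2 / 2)) / x) has_field_derivative
      std_normal_density x - slab_marginal x) (at x)"
    using False by (simp add: slab_marginal_def std_normal_density_def c_def)
  moreover have "eventually (\<lambda>y. y \<noteq> 0) (nhds x)"
    using False by (rule t1_space_nhds)
  then have "eventually (\<lambda>y. y * slab_marginal y = 1 / sqrt (2 * pi) * (1 - exp (- y\<^sup>2 / 2)) / y) (nhds x)"
    by eventually_elim (simp add: slab_marginal_def power2_eq_square)
  ultimately show ?thesis
    by (subst DERIV_cong_ev[OF refl _ refl])
qed

lemma has_field_derivative_std_normal_density:
  "(std_normal_density has_field_derivative - x * std_normal_density x) (at x)"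
proof -
  have "((\<lambda>x. 1 / c * exp (- x\<^sup>2 / 2)) has_field_derivative - x * (1 / c * exp (- x\<^sup>2 / 2))) (at x)"
    for c :: real
    by (rule derivative_eq_intros refl | simp)+
  then show ?thesis
    unfolding std_normal_density_def .
qed

lemma isCont_std_normal_density: "isCont std_normal_density x"
  unfolding std_normal_density_def by (intro continuous_intros) auto

text \<open>Over the whole line the value would be 0, both densities having mass 1. Cutting at z
  removes more slab mass than normal mass, and the right-hand side is exactly this deficit.\<close>

lemma integral_truncated_likelihood_ratio:
  assumes "0 \<le> z"
  shows "(LINT x|std_normal_distribution. indicator {-z..z} x * (likelihood_ratio x - 1)) =
    - 2 * z * slab_marginal z"
proof -
  have eq: "std_normal_density x * (indicator {-z..z} x * (likelihood_ratio x - 1)) =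
      indicator {-z..z} x *\<^sub>R (slab_marginal x - std_normal_density x)" for x
    unfolding std_normal_density_times_likelihood_ratio[symmetric] by (simp add: right_diff_distrib)
  have "(LINT x|std_normal_distribution. indicator {-z..z} x * (likelihood_ratio x - 1)) =
      (LINT x|lborel. std_normal_density x * (indicator {-z..z} x * (likelihood_ratio x - 1)))"
    by (subst integral_density) auto
  also have "\<dots> = (LINT x|lborel. indicator {-z..z} x *\<^sub>R (slab_marginal x - std_normal_density x))"
    by (simp only: eq)
  also have "\<dots> = - (z * slab_marginal z) - - (- z * slab_marginal (- z))"
  proof (rule integral_FTC_atLeastAtMost)
    show "continuous_on {-z..z} (\<lambda>x. slab_marginal x - std_normal_density x)"
      by (intro continuous_at_imp_continuous_on ballI continuous_diff isCont_slab_marginal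
          isCont_std_normal_density)
    show "((\<lambda>x. - (x * slab_marginal x)) has_vector_derivative slab_marginal x - std_normal_density x)
        (at x within {-z..z})" for x
      using DERIV_minus[OF has_field_derivative_times_slab_marginal[of x]]
      by (auto intro: has_vector_derivative_at_within simp: has_real_derivative_iff_has_vector_derivative)
  qed (use assms in auto)
  finally show ?thesis
    by (simp add: slab_marginal_def)
qed

section \<open>Two-sided standard normal tails\<close>

interpretation std_normal: real_distribution std_normal_distribution
  by (rule real_dist_normal_dist)

definition normal_tail :: "real \<Rightarrow> real" where
  "normal_tail z = measure std_normal_distribution {x. z < \<bar>x\<bar>}"

lemma normal_tail_nonneg: "0 \<le> normal_tail z"
  by (simp add: normal_tail_def)

lemma normal_tail_le_1: "normal_tail z \<le> 1"
  by (simp add: normal_tail_def)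

lemma normal_tail_antimono: "a \<le> b \<Longrightarrow> normal_tail b \<le> normal_tail a"
  unfolding normal_tail_def by (intro std_normal.finite_measure_mono) auto

lemma std_normal_measure_singleton: "measure std_normal_distribution {x} = 0"
proof -
  have "emeasure std_normal_distribution {x} = (\<integral>\<^sup>+ y. ennreal (std_normal_density y) * indicator {x} y \<partial>lborel)"
    by (simp add: emeasure_density)
  also have "\<dots> = 0"
  proof (rule nn_integral_zero')
    show "AE y in lborel. ennreal (std_normal_density y) * indicator {x} y = 0"
      using AE_lborel_singleton[of x] by eventually_elim simp
  qed
  finally show ?thesis
    by (simp add: measure_def)
qed

lemma normal_tail_cdf:
  assumes "0 \<le> z"
  shows "normal_tail z = 1 - cdf std_normal_distribution z + cdf std_normal_distribution (- z)"
proof -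
  have "{x. z < \<bar>x\<bar>} = {z<..} \<union> {..<-z}"
    using assms by auto
  then have "normal_tail z = measure std_normal_distribution {z<..} + measure std_normal_distribution {..<-z}"
    using assms unfolding normal_tail_def by (auto intro!: std_normal.finite_measure_Union)
  moreover have "measure std_normal_distribution {z<..} = 1 - cdf std_normal_distribution z"
    using std_normal.prob_compl[of "{..z}"] by (simp add: cdf_def Compl_eq_Diff_UNIV[symmetric])
  \<comment> \<open>The cdf measures the closed half-line; its end point is a null set.\<close>
  moreover have "cdf std_normal_distribution (- z) = measure std_normal_distribution {..<-z}"
    unfolding cdf_def ivl_disj_un(2)[symmetric]
    by (subst std_normal.finite_measure_Union) (auto simp: std_normal_measure_singleton)
  ultimately show ?thesis
    by simp
qed

lemma normal_tail_tendsto_0: "(normal_tail \<longlongrightarrow> 0) at_top"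
proof -
  have "((\<lambda>z. 1 - cdf std_normal_distribution z + cdf std_normal_distribution (- z)) \<longlongrightarrow> 1 - 1 + 0) at_top"
    by (intro tendsto_intros std_normal.cdf_lim_at_top_prob
        filterlim_compose[OF std_normal.cdf_lim_at_bot filterlim_uminus_at_bot_at_top])
  moreover have "eventually (\<lambda>z. 1 - cdf std_normal_distribution z + cdf std_normal_distribution (- z)
      = normal_tail z) at_top"
    using eventually_ge_at_top[of 0] by eventually_elim (simp add: normal_tail_cdf)
  ultimately show ?thesis
    by (auto intro: Lim_transform_eventually)
qed

text \<open>Supplies thresholds with a prescribed exceedance probability, so that expected
  exceedance counts are known exactly. By intermediate values: the cdf expression is continuous,
  equals 1 at 0 and falls below q.\<close>

lemma normal_tail_surj:
  assumes "0 < q" "q < 1"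
  shows "\<exists>z\<ge>0. normal_tail z = q"
proof -
  let ?f = "\<lambda>z. 1 - cdf std_normal_distribution z + cdf std_normal_distribution (- z)"
  have "eventually (\<lambda>z. normal_tail z < q) at_top"
    using order_tendstoD(2)[OF normal_tail_tendsto_0 assms(1)] .
  then obtain b where b: "b \<ge> 0" "normal_tail b < q"
    using eventually_happens'[OF _ eventually_conj[OF eventually_ge_at_top[of 0]]]
    by (metis trivial_limit_at_top_linorder)
  have cont: "isCont (cdf std_normal_distribution) x" for x
    by (simp add: std_normal.isCont_cdf std_normal_measure_singleton)
  have "\<forall>z. 0 \<le> z \<and> z \<le> b \<longrightarrow> isCont ?f z"
    by (auto intro!: continuous_intros cont isCont_o2[OF isCont_minus[OF continuous_ident] cont])
  then have "\<exists>z\<ge>0. z \<le> b \<and> ?f z = q"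
    using b assms by (intro IVT2) (simp_all add: normal_tail_cdf)
  then show ?thesis
    by (auto simp: normal_tail_cdf)
qed

lemma mills_ratio_bound:
  assumes "0 < z"
  shows "normal_tail z \<le> 2 * std_normal_density z / z"
proof -
  let ?d = std_normal_density
  have upper: "(\<integral>\<^sup>+ x. ennreal (?d x) * indicator {z<..} x \<partial>lborel) \<le> ennreal (?d z / z)"
  proof -
    \<comment> \<open>Beyond z the factor x/z is at least 1, and x times the density has an explicit
      antiderivative.\<close>
    have "(\<integral>\<^sup>+ x. ennreal (?d x) * indicator {z<..} x \<partial>lborel) \<le>
        (\<integral>\<^sup>+ x. ennreal (x / z * ?d x) * indicator {z..} x \<partial>lborel)"
    proof (rule nn_integral_mono)
      fix x
      show "ennreal (?d x) * indicator {z<..} x \<le> ennreal (x / z * ?d x) * indicator {z..} x"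
      proof (cases "z < x")
        case True
        then have "1 * ?d x \<le> x / z * ?d x"
          using assms by (intro mult_right_mono) auto
        then show ?thesis
          using True by (simp add: ennreal_leI)
      qed simp
    qed
    also have "\<dots> = ennreal (0 - (- (?d z / z)))"
    proof (rule nn_integral_FTC_atLeast[where F = "\<lambda>x. - (?d x / z)"])
      show "((\<lambda>x. - (?d x / z)) has_real_derivative x / z * ?d x) (at x)" for x
        using DERIV_cmult[OF has_field_derivative_std_normal_density, of "- 1 / z" x] by simp
      show "((\<lambda>x. - (?d x / z)) \<longlongrightarrow> 0) at_top"
        unfolding std_normal_density_def using assms by real_asymp
    qed (use assms in auto)
    finally show ?thesis
      by simp
  qed
  have lower: "(\<integral>\<^sup>+ x. ennreal (?d x) * indicator {..<-z} x \<partial>lborel) =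
      (\<integral>\<^sup>+ x. ennreal (?d x) * indicator {z<..} x \<partial>lborel)"
    by (subst nn_integral_real_affine[where c = "-1" and t = 0])
       (auto simp: std_normal_density_def indicator_def intro!: nn_integral_cong)
  have "{x. z < \<bar>x\<bar>} = {z<..} \<union> {..<-z}" "{z<..} \<inter> {..<-z} = {}"
    using assms by auto
  then have "emeasure std_normal_distribution {x. z < \<bar>x\<bar>} =
      emeasure std_normal_distribution {z<..} + emeasure std_normal_distribution {..<-z}"
    by (auto intro!: plus_emeasure[symmetric])
  also have "\<dots> \<le> ennreal (?d z / z) + ennreal (?d z / z)"
    using upper lower by (intro add_mono) (simp_all add: emeasure_density)
  also have "\<dots> = ennreal (2 * ?d z / z)"
    using assms by (simp flip: ennreal_plus)
  finally show ?thesis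
    using assms unfolding normal_tail_def
    by (auto simp: std_normal.emeasure_eq_measure)
qed

section \<open>The cumulative procedure for a fixed observation\<close>

lemma mixture_pos:
  assumes "0 \<le> w" "w \<le> 1"
  shows "0 < 1 + w * (likelihood_ratio x - 1)"
proof -
  have "w * (1 / 2) \<le> w * likelihood_ratio x"
    using assms likelihood_ratio_ge_half by (intro mult_left_mono) auto
  then show ?thesis
    using assms by (simp add: algebra_simps)
qed

lemma mixture_eq:
  "(1 - w) * std_normal_density x + w * slab_marginal x =
    std_normal_density x * (1 + w * (likelihood_ratio x - 1))"
  unfolding std_normal_density_times_likelihood_ratio[symmetric] by (simp add: algebra_simps)

lemma std_normal_density_positive: "0 < std_normal_density x"
  by (simp add: std_normal_density_def)

lemma ell_value_eq: "ell_value w x = (1 - w) / (1 + w * (likelihood_ratio x - 1))"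
  using std_normal_density_positive[of x] by (simp add: ell_value_def mixture_eq)

lemma ell_value_nonneg: "0 \<le> w \<Longrightarrow> w \<le> 1 \<Longrightarrow> 0 \<le> ell_value w x"
  using mixture_pos[of w x] by (simp add: ell_value_eq)

lemma ell_value_less_1: "0 < w \<Longrightarrow> w \<le> 1 \<Longrightarrow> ell_value w x < 1"
  using mixture_pos[of w x] likelihood_ratio_pos[of x] by (simp add: ell_value_eq algebra_simps)

lemma ell_value_antimono:
  assumes "0 \<le> w" "w \<le> 1" "\<bar>x\<bar> \<le> \<bar>y\<bar>"
  shows "ell_value w y \<le> ell_value w x"
  unfolding ell_value_eq using assms likelihood_ratio_mono[of x y] mixture_pos[of w x] mixture_pos[of w y]
  by (intro divide_left_mono mult_pos_pos add_left_mono mult_left_mono) auto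

text \<open>At w = 1 all l-values are 0, so strictness requires w < 1.\<close>

lemma ell_value_strict_antimono:
  assumes "0 < w" "w < 1" "\<bar>x\<bar> < \<bar>y\<bar>"
  shows "ell_value w y < ell_value w x"
  unfolding ell_value_eq
  using assms likelihood_ratio_strict_mono[of x y] mixture_pos[of w x] mixture_pos[of w y]
  by (intro divide_strict_left_mono mult_pos_pos add_strict_left_mono mult_strict_left_mono) auto

lemma ell_value_antimono_weight:
  assumes "0 \<le> w" "w \<le> w'" "w' \<le> 1"
  shows "ell_value w' x \<le> ell_value w x"
proof -
  have "w * likelihood_ratio x \<le> w' * likelihood_ratio x"
    using assms likelihood_ratio_pos[of x] by (intro mult_right_mono) auto
  then have "(1 - w') * (1 + w * (likelihood_ratio x - 1)) \<le> (1 - w) * (1 + w' * (likelihood_ratio x - 1))"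
    by (simp add: algebra_simps)
  then show ?thesis
    using assms mixture_pos[of w x] mixture_pos[of w' x] by (simp add: ell_value_eq divide_simps mult.commute)
qed

lemma ell_value_measurable [measurable (raw)]:
  assumes [measurable]: "f \<in> borel_measurable M" "g \<in> borel_measurable M"
  shows "(\<lambda>x. ell_value (f x) (g x)) \<in> borel_measurable M"
  unfolding ell_value_eq by measurable

section \<open>The score and the maximizer of the marginal likelihood\<close>

definition score :: "nat \<Rightarrow> (nat \<Rightarrow> real) \<Rightarrow> real \<Rightarrow> real" where
  "score n X w = (\<Sum>i\<in>{1..n}. (likelihood_ratio (X i) - 1) / (1 + w * (likelihood_ratio (X i) - 1)))"

lemma log_marginal_eq:
  assumes "0 \<le> w" "w \<le> 1"
  shows "log_marginal n X w =
    (\<Sum>i\<in>{1..n}. ln (std_normal_density (X i)) + ln (1 + w * (likelihood_ratio (X i) - 1)))"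
  unfolding log_marginal_def mixture_eq using mixture_pos[OF assms]
  by (intro sum.cong refl ln_mult_pos) (auto simp: std_normal_density_positive)

text \<open>Strict concavity of the log-likelihood, with its derivative \<open>score\<close> as the
  slope of the tangent at c. Per coordinate it is ln y <= y - 1, where y is the quotient of the
  mixture factors at w and at c. A coordinate whose likelihood ratio differs from 1 has y different
  from 1, where the inequality is strict.\<close>

lemma log_marginal_less_tangent:
  assumes "0 \<le> w" "w \<le> 1" "0 \<le> c" "c \<le> 1" "w \<noteq> c"
    and "\<exists>i\<in>{1..n}. likelihood_ratio (X i) \<noteq> 1"
  shows "log_marginal n X w < log_marginal n X c + score n X c * (w - c)"
proof -
  let ?b = "\<lambda>i. likelihood_ratio (X i) - 1"
  have *: "ln (1 + w * ?b i) \<le> ln (1 + c * ?b i) + ?b i / (1 + c * ?b i) * (w - c)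
      \<and> (?b i \<noteq> 0 \<longrightarrow> ln (1 + w * ?b i) < ln (1 + c * ?b i) + ?b i / (1 + c * ?b i) * (w - c))" for i
  proof -
    have pos: "0 < 1 + w * ?b i" "0 < 1 + c * ?b i"
      using assms mixture_pos by auto
    define y where "y = (1 + w * ?b i) / (1 + c * ?b i)"
    have y: "0 < y" "y - 1 = ?b i / (1 + c * ?b i) * (w - c)"
      using pos by (auto simp: y_def field_simps)
    have "ln y = ln (1 + w * ?b i) - ln (1 + c * ?b i)"
      using pos by (simp add: y_def ln_div)
    moreover have "?b i \<noteq> 0 \<longrightarrow> y \<noteq> 1"
      using y(2) pos assms(5) by auto
    ultimately show ?thesis
      using ln_le_minus_one[OF y(1)] ln_eq_minus_one[OF y(1)] y(2) by force
  qed
  have "(\<Sum>i\<in>{1..n}. ln (std_normal_density (X i)) + ln (1 + w * ?b i)) <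
      (\<Sum>i\<in>{1..n}. ln (std_normal_density (X i)) + (ln (1 + c * ?b i) + ?b i / (1 + c * ?b i) * (w - c)))"
    using assms(6) * by (intro sum_strict_mono_ex1) auto
  also have "\<dots> = log_marginal n X c + score n X c * (w - c)"
    using assms by (simp add: log_marginal_eq score_def sum.distrib sum_distrib_right)
  finally show ?thesis
    using assms by (simp add: log_marginal_eq)
qed

text \<open>\<open>arg_max_on\<close> is a choice operator: only after compactness has produced some
  maximizer is the chosen value known to be one.\<close>

lemma w_hat_maximal:
  assumes "1 \<le> n"
  shows "1 / real n \<le> w_hat n X" "w_hat n X \<le> 1"
    and "\<And>w. 1 / real n \<le> w \<Longrightarrow> w \<le> 1 \<Longrightarrow> log_marginal n X w \<le> log_marginal n X (w_hat n X)"
proof -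
  have "continuous_on {1 / real n..1} (log_marginal n X)"
    unfolding log_marginal_def mixture_eq
  proof (intro continuous_intros ballI)
    fix i w assume "w \<in> {1 / real n..1}"
    then have "0 \<le> w" "w \<le> 1"
      by (auto intro: order_trans[rotated])
    then show "std_normal_density (X i) * (1 + w * (likelihood_ratio (X i) - 1)) \<noteq> 0"
      using mixture_pos[of w "X i"] std_normal_density_positive[of "X i"] by auto
  qed
  moreover have "{1 / real n..1} \<noteq> {}"
    using assms by auto
  ultimately obtain w0 where "w0 \<in> {1 / real n..1}"
      "\<forall>w\<in>{1 / real n..1}. log_marginal n X w \<le> log_marginal n X w0"
    using continuous_attains_sup[of "{1 / real n..1}"] by blast
  then have "is_arg_max (log_marginal n X) (\<lambda>w. w \<in> {1 / real n..1}) w0"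
    by (auto simp: is_arg_max_linorder)
  then have "is_arg_max (log_marginal n X) (\<lambda>w. w \<in> {1 / real n..1}) (w_hat n X)"
    unfolding w_hat_def arg_max_on_def arg_max_def by (rule someI)
  then show "1 / real n \<le> w_hat n X" "w_hat n X \<le> 1"
      "\<And>w. 1 / real n \<le> w \<Longrightarrow> w \<le> 1 \<Longrightarrow> log_marginal n X w \<le> log_marginal n X (w_hat n X)"
    by (auto simp: is_arg_max_linorder)
qed

lemma w_hat_pos: "1 \<le> n \<Longrightarrow> 0 < w_hat n X"
  using w_hat_maximal(1)[of n X] by (metis divide_pos_pos less_le_trans of_nat_0_less_iff zero_less_one less_eq_Suc_le One_nat_def)

text \<open>A maximizer beyond c would lie under the tangent at c, whose slope is nonpositive, and
  so have strictly smaller likelihood than c. \<open>w_hat_ge\<close> is the mirror image.\<close>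

lemma w_hat_le:
  assumes "1 \<le> n" "1 / real n \<le> c" "c \<le> 1" "score n X c \<le> 0"
    and "\<exists>i\<in>{1..n}. likelihood_ratio (X i) \<noteq> 1"
  shows "w_hat n X \<le> c"
proof (rule ccontr)
  assume "\<not> w_hat n X \<le> c"
  then have gt: "c < w_hat n X"
    by simp
  have "0 \<le> c"
    using assms(2) by (rule order_trans[rotated]) simp
  then have "log_marginal n X (w_hat n X) < log_marginal n X c + score n X c * (w_hat n X - c)"
    using gt assms w_hat_maximal(2) by (intro log_marginal_less_tangent) auto
  moreover have "score n X c * (w_hat n X - c) \<le> 0"
    using gt assms by (intro mult_nonpos_nonneg) auto
  ultimately show False
    using w_hat_maximal(3)[OF assms(1,2,3), of X] by linarith
qed

lemma w_hat_ge:
  assumes "1 \<le> n" "1 / real n \<le> c" "c \<le> 1" "0 \<le> score n X c"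
    and "\<exists>i\<in>{1..n}. likelihood_ratio (X i) \<noteq> 1"
  shows "c \<le> w_hat n X"
proof (rule ccontr)
  assume "\<not> c \<le> w_hat n X"
  then have gt: "w_hat n X < c"
    by simp
  have "0 \<le> c"
    using assms(2) by (rule order_trans[rotated]) simp
  then have "log_marginal n X (w_hat n X) < log_marginal n X c + score n X c * (w_hat n X - c)"
    using gt assms w_hat_pos[OF assms(1), of X] by (intro log_marginal_less_tangent) auto
  moreover have "score n X c * (w_hat n X - c) \<le> 0"
    using gt assms by (intro mult_nonneg_nonpos) auto
  ultimately show False
    using w_hat_maximal(3)[OF assms(1,2,3), of X] by linarith
qed

lemma score_nonzeroD: "score n X c \<noteq> 0 \<Longrightarrow> \<exists>i\<in>{1..n}. likelihood_ratio (X i) \<noteq> 1"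
  unfolding score_def by (rule ccontr) (auto intro!: sum.neutral)

text \<open>If all likelihood ratios equal 1, the log-likelihood does not depend on \<open>w\<close>, so that every
  such \<open>X\<close> yields the same (arbitrary) maximizer. This makes \<open>w_hat\<close> measurable.\<close>

lemma w_hat_degenerate:
  assumes "1 \<le> n" "\<forall>i\<in>{1..n}. likelihood_ratio (X i) = 1"
  shows "w_hat n X = (SOME w. w \<in> {1 / real n..1})"
proof -
  have "log_marginal n X w = (\<Sum>i\<in>{1..n}. ln (std_normal_density (X i)))" for w
    using assms(2) by (simp add: log_marginal_def mixture_eq)
  then show ?thesis
    by (simp add: w_hat_def arg_max_on_def arg_max_def is_arg_max_def)
qed

lemma score_measurable [measurable]:
  "(\<lambda>X. score n X w) \<in> borel_measurable (\<Pi>\<^sub>M i\<in>{1..n}. borel)"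
  unfolding score_def by measurable

lemma w_hat_measurable [measurable]:
  assumes "1 \<le> n"
  shows "w_hat n \<in> borel_measurable (\<Pi>\<^sub>M i\<in>{1..n}. borel)"
  unfolding borel_measurable_iff_less
proof
  fix a
  let ?M = "\<Pi>\<^sub>M i\<in>{1..n}. (borel :: real measure)"
  define D where "D = {X \<in> space ?M. \<forall>i\<in>{1..n}. likelihood_ratio (X i) = 1}"
  \<comment> \<open>For a <= 1 and X outside \<open>D\<close>, the maximizer is below a exactly if
    the score is nonpositive at some admissible rational q < a; rationals keep the union countable.
    The case 1 < a is separate because \<open>w_hat\<close> may equal 1, and then no admissible q
    lies above it.\<close>
  define K where "K = (\<Union>q\<in>\<rat> \<inter> {1 / real n..1} \<inter> {..<a}. {X \<in> space ?M. score n X q \<le> 0})"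
  have [measurable]: "D \<in> sets ?M"
    unfolding D_def by measurable
  have "countable (\<rat> \<inter> {1 / real n..1} \<inter> {..<a})"
    by (intro countable_Int1 countable_rat)
  then have [measurable]: "K \<in> sets ?M"
    unfolding K_def by (intro sets.countable_UN' image_subsetI) measurable
  have K: "w_hat n X < a \<longleftrightarrow> 1 < a \<or> X \<in> K" if "X \<in> space ?M" "X \<notin> D" for X
  proof
    have ex: "\<exists>i\<in>{1..n}. likelihood_ratio (X i) \<noteq> 1"
      using that by (auto simp: D_def)
    assume less: "w_hat n X < a"
    show "1 < a \<or> X \<in> K"
    proof (rule disjCI)
      assume "X \<notin> K"
      show "1 < a"
      proof (rule ccontr)
        assume "\<not> 1 < a"
        obtain q where q: "q \<in> \<rat>" "w_hat n X < q" "q < a"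
          using Rats_dense_in_real[OF less] by blast
        then have range: "1 / real n \<le> q" "q \<le> 1"
          using w_hat_maximal(1)[OF assms, of X] \<open>\<not> 1 < a\<close> by linarith+
        then have "0 < score n X q"
          using q \<open>X \<notin> K\<close> that by (force simp: K_def)
        then have "q \<le> w_hat n X"
          using assms ex range by (intro w_hat_ge) auto
        then show False
          using q by simp
      qed
    qed
  next
    have ex: "\<exists>i\<in>{1..n}. likelihood_ratio (X i) \<noteq> 1"
      using that by (auto simp: D_def)
    assume "1 < a \<or> X \<in> K"
    then show "w_hat n X < a"
    proof
      assume "1 < a"
      then show ?thesis
        using w_hat_maximal(2)[OF assms, of X] by simp
    next
      assume "X \<in> K"
      then obtain q where "1 / real n \<le> q" "q \<le> 1" "q < a" "score n X q \<le> 0"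
        by (auto simp: K_def)
      with w_hat_le[OF assms _ _ _ ex] show ?thesis
        by fastforce
    qed
  qed
  have D: "w_hat n X < a \<longleftrightarrow> (SOME w. w \<in> {1 / real n..1}) < a" if "X \<in> D" for X
    using w_hat_degenerate[OF assms] that by (simp add: D_def)
  have "{X \<in> space ?M. w_hat n X < a} =
      {X \<in> space ?M. if X \<in> D then (SOME w. w \<in> {1 / real n..1}) < a else 1 < a \<or> X \<in> K}"
    using K D by auto
  also have "\<dots> \<in> sets ?M"
    by measurable
  finally show "{X \<in> space ?M. w_hat n X < a} \<in> sets ?M" .
qed

section \<open>The rejection rule as a sign condition on sums of l-values\<close>

lemma sum_diff_const_mono:
  fixes e :: "'a \<Rightarrow> real"
  assumes "finite B" "A \<subseteq> B" "\<And>a b. a \<in> A \<Longrightarrow> b \<in> B - A \<Longrightarrow> e a \<le> e b"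
    and "(\<Sum>j\<in>B. e j - t) \<le> 0"
  shows "(\<Sum>j\<in>A. e j - t) \<le> 0"
proof (cases "\<exists>a\<in>A. t < e a")
  \<comment> \<open>A value above t inside A forces all of B - A above t, so dropping B - A lowers
    the sum. Otherwise every summand over A is nonpositive.\<close>
  case True
  then obtain a where a: "a \<in> A" "t < e a"
    by auto
  have "(\<Sum>j\<in>A. e j - t) \<le> (\<Sum>j\<in>B. e j - t)"
  proof (rule sum_mono2)
    show "0 \<le> e b - t" if "b \<in> B - A" for b
      using assms(3)[OF a(1) that] a(2) by simp
  qed (use assms in auto)
  then show ?thesis
    using assms by linarith
qed (auto intro!: sum_nonpos simp: not_less)

text \<open>The right-hand side is free of the supremum in \<open>lambda_hat\<close>, which makes the rejection rule
  visibly measurable and comparable with fixed thresholds.\<close>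

lemma less_Sup_average_iff:
  fixes e :: "'a \<Rightarrow> real"
  assumes "finite A" "i \<in> A" "0 \<le> t" "\<And>j. j \<in> A \<Longrightarrow> 0 \<le> e j" "\<And>j. j \<in> A \<Longrightarrow> e j < 1"
  shows "e i < Sup {u\<in>{0..1}. (\<Sum>j\<in>A. e j * of_bool (e j < u)) / max 1 (\<Sum>j\<in>A. of_bool (e j < u)) \<le> t}
    \<longleftrightarrow> (\<Sum>j\<in>{j\<in>A. e j \<le> e i}. e j - t) \<le> 0"
proof -
  define U where "U = {u\<in>{0..1}. (\<Sum>j\<in>A. e j * of_bool (e j < u)) / max 1 (\<Sum>j\<in>A. of_bool (e j < u)) \<le> t}"
  \<comment> \<open>At u = 0 nothing is selected and the guarded quotient is 0, so the supremum is
    over a nonempty set.\<close>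
  have "(\<Sum>j\<in>A. e j * of_bool (e j < 0)) = 0"
    using assms by (intro sum.neutral) (auto simp: not_less[symmetric])
  then have "0 \<in> U"
    using assms by (simp add: U_def)
  then have less: "e i < Sup U \<longleftrightarrow> (\<exists>u\<in>U. e i < u)"
    by (intro less_cSup_iff bdd_aboveI[of _ 1]) (blast, simp add: U_def)
  have avg: "u \<in> U \<longleftrightarrow> (\<Sum>j\<in>{j\<in>A. e j < u}. e j - t) \<le> 0" if "e i < u" "u \<in> {0..1}" for u
  proof -
    have "{j\<in>A. e j < u} \<noteq> {}"
      using that assms by auto
    then have card: "1 \<le> real (card {j\<in>A. e j < u})"
      using assms by (simp add: Suc_le_eq card_gt_0_iff)
    have "(\<Sum>j\<in>A. of_bool (e j < u)) = real (card {j\<in>A. e j < u})"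
      using assms by (simp add: Int_def)
    moreover have "(\<Sum>j\<in>A. e j * of_bool (e j < u)) = (\<Sum>j\<in>{j\<in>A. e j < u}. e j)"
      using assms by (simp add: Int_def)
    ultimately show ?thesis
      using card that by (simp add: U_def sum_subtractf field_simps)
  qed
  show ?thesis
    unfolding U_def[symmetric] less
  proof
    assume "\<exists>u\<in>U. e i < u"
    then obtain u where u: "u \<in> U" "e i < u"
      by auto
    then have "(\<Sum>j\<in>{j\<in>A. e j < u}. e j - t) \<le> 0"
      using avg[of u] by (auto simp: U_def)
    then show "(\<Sum>j\<in>{j\<in>A. e j \<le> e i}. e j - t) \<le> 0"
      by (rule sum_diff_const_mono[rotated 3]) (use assms u in auto)
  next
    assume le: "(\<Sum>j\<in>{j\<in>A. e j \<le> e i}. e j - t) \<le> 0"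
    \<comment> \<open>The next larger value of e, or 1 if there is none: no value lies strictly
      between \<open>e i\<close> and u, so being below u means being at most
      \<open>e i\<close>.\<close>
    define u where "u = Min (insert 1 (e ` {j\<in>A. e i < e j}))"
    have fin: "finite (insert 1 (e ` {j\<in>A. e i < e j}))"
      using assms by simp
    have u: "e i < u" "u \<le> 1"
      unfolding u_def using fin assms by (auto simp: Min_gr_iff)
    have "{j\<in>A. e j < u} = {j\<in>A. e j \<le> e i}"
    proof (intro Collect_cong conj_cong refl)
      fix j assume "j \<in> A"
      then have "e i < e j \<Longrightarrow> u \<le> e j"
        unfolding u_def using fin by (intro Min_le) auto
      then show "e j < u \<longleftrightarrow> e j \<le> e i"
        using u(1) by force
    qed
    then have "u \<in> U"
      using avg[of u] u le assms(4)[OF assms(2)] by auto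
    then show "\<exists>u\<in>U. e i < u"
      using u by auto
  qed
qed

lemma cumulative_ell_iff:
  assumes "1 \<le> n" "0 \<le> t" "i \<in> {1..n}"
  shows "cumulative_ell n t X i \<longleftrightarrow>
    (\<Sum>j\<in>{j\<in>{1..n}. ell_value (w_hat n X) (X j) \<le> ell_value (w_hat n X) (X i)}.
      ell_value (w_hat n X) (X j) - t) \<le> 0"
  unfolding cumulative_ell_def lambda_hat_def
  using assms w_hat_pos[OF assms(1), of X] w_hat_maximal(2)[OF assms(1), of X]
  by (intro less_Sup_average_iff) (auto simp: ell_value_nonneg ell_value_less_1)

text \<open>If some i with |X i| <= z were rejected, its sublevel set would contain all indices
  beyond z, and its nonpositive sum would pass to that smaller set with the smaller
  l-values.\<close>

lemma cumulative_ell_imp_gt: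
  assumes "1 \<le> n" "0 \<le> t" "i \<in> {1..n}"
    and "0 < (\<Sum>j\<in>{j\<in>{1..n}. z < \<bar>X j\<bar>}. ell_value (w_hat n X) (X j) - t)"
    and "cumulative_ell n t X i"
  shows "z < \<bar>X i\<bar>"
proof (rule ccontr)
  assume not: "\<not> z < \<bar>X i\<bar>"
  have w: "0 \<le> w_hat n X" "w_hat n X \<le> 1"
    using w_hat_pos[OF assms(1), of X] w_hat_maximal(2)[OF assms(1), of X] by auto
  have "(\<Sum>j\<in>{j\<in>{1..n}. z < \<bar>X j\<bar>}. ell_value (w_hat n X) (X j) - t) \<le> 0"
    by (rule sum_diff_const_mono[OF _ _ _ cumulative_ell_iff[OF assms(1-3), THEN iffD1, OF assms(5)]])
       (use not w in \<open>auto intro!: ell_value_antimono\<close>)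
  then show False
    using assms by simp
qed

text \<open>For a weight below 1 the l-values are strictly decreasing in |x|, so the sublevel set of
  an index beyond z stays beyond z and inherits the nonpositive sum.\<close>

lemma cumulative_ellI:
  assumes "1 \<le> n" "0 \<le> t" "i \<in> {1..n}" "w_hat n X < 1"
    and "(\<Sum>j\<in>{j\<in>{1..n}. z < \<bar>X j\<bar>}. ell_value (w_hat n X) (X j) - t) \<le> 0"
    and "z < \<bar>X i\<bar>"
  shows "cumulative_ell n t X i"
  unfolding cumulative_ell_iff[OF assms(1-3)]
proof (rule sum_diff_const_mono[OF _ _ _ assms(5)])
  have w: "0 < w_hat n X"
    using w_hat_pos[OF assms(1), of X] by auto
  show "{j \<in> {1..n}. ell_value (w_hat n X) (X j) \<le> ell_value (w_hat n X) (X i)} \<subseteq> {j \<in> {1..n}. z < \<bar>X j\<bar>}"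
    using ell_value_strict_antimono[OF w assms(4)] assms(6) by (force simp: not_le[symmetric])
qed auto

text \<open>The error rates are Bochner integrals, which default to 0 on integrands that are not
  measurable; convergence of the FDR to t therefore depends on this fact.\<close>

lemma cumulative_ell_measurable [measurable]:
  assumes "1 \<le> n" "0 \<le> t" "i \<in> {1..n}"
  shows "Measurable.pred (\<Pi>\<^sub>M i\<in>{1..n}. borel) (\<lambda>X. cumulative_ell n t X i)"
proof -
  have eq: "cumulative_ell n t X i \<longleftrightarrow>
      (\<Sum>j\<in>{1..n}. if ell_value (w_hat n X) (X j) \<le> ell_value (w_hat n X) (X i)
        then ell_value (w_hat n X) (X j) - t else 0) \<le> 0" for X
    unfolding cumulative_ell_iff[OF assms] sum.inter_filter[OF finite_atLeastAtMost] ..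
  have [measurable]: "w_hat n \<in> borel_measurable (\<Pi>\<^sub>M i\<in>{1..n}. borel)"
    using assms(1) by (rule w_hat_measurable)
  have [measurable]: "(\<lambda>X. X i) \<in> borel_measurable (\<Pi>\<^sub>M i\<in>{1..n}. borel)"
    using assms(3) by (rule measurable_component_singleton)
  show ?thesis
    unfolding eq by measurable
qed

lemma FDP_measurable:
  assumes "1 \<le> n" "0 \<le> t"
  shows "(\<lambda>X. FDP n (cumulative_ell n t X) \<theta>) \<in> borel_measurable (\<Pi>\<^sub>M i\<in>{1..n}. borel)"
proof -
  have [measurable]: "i \<in> {1..n} \<Longrightarrow> Measurable.pred (\<Pi>\<^sub>M i\<in>{1..n}. borel) (\<lambda>X. cumulative_ell n t X i)" for i
    using assms by (intro cumulative_ell_measurable)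
  show ?thesis
    unfolding FDP_def by measurable
qed

lemma FNP_measurable:
  assumes "1 \<le> n" "0 \<le> t"
  shows "(\<lambda>X. (\<Sum>i\<in>{1..n}. of_bool (\<theta> i \<noteq> 0 \<and> \<not> cumulative_ell n t X i)) /
      max 1 (\<Sum>i\<in>{1..n}. of_bool (\<theta> i \<noteq> 0)) :: real) \<in> borel_measurable (\<Pi>\<^sub>M i\<in>{1..n}. borel)"
proof -
  have [measurable]: "i \<in> {1..n} \<Longrightarrow> Measurable.pred (\<Pi>\<^sub>M i\<in>{1..n}. borel) (\<lambda>X. cumulative_ell n t X i)" for i
    using assms by (intro cumulative_ell_measurable)
  show ?thesis
    by measurable
qed

section \<open>Concentration for sums over the noise\<close>

lemma prob_space_noise: "prob_space (noise n)"
  unfolding noise_def by (intro prob_space_PiM prob_space_normal_density) simp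

lemma sets_noise [measurable_cong]: "sets (noise n) = sets (\<Pi>\<^sub>M i\<in>{1..n}. borel)"
  unfolding noise_def by (intro sets_PiM_cong) auto

lemma measurable_shift:
  "(\<lambda>\<epsilon>. \<lambda>i\<in>{1..n}. \<theta> i + \<epsilon> i) \<in> noise n \<rightarrow>\<^sub>M (\<Pi>\<^sub>M i\<in>{1..n}. (borel :: real measure))"
  by measurable

lemma integral_law:
  fixes F :: "(nat \<Rightarrow> real) \<Rightarrow> real"
  assumes "F \<in> borel_measurable (\<Pi>\<^sub>M i\<in>{1..n}. borel)"
  shows "(LINT X|law n \<theta>. F X) = (LINT \<epsilon>|noise n. F (\<lambda>i\<in>{1..n}. \<theta> i + \<epsilon> i))"
  unfolding law_def by (rule integral_distr[OF measurable_shift assms])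

lemma (in prob_space) abs_expectation_le_off_event:
  fixes F :: "'a \<Rightarrow> real"
  assumes [measurable]: "F \<in> borel_measurable M" "B \<in> events"
    and "\<And>x. x \<in> space M \<Longrightarrow> \<bar>F x\<bar> \<le> 1" "\<And>x. x \<in> space M \<Longrightarrow> x \<notin> B \<Longrightarrow> \<bar>F x\<bar> \<le> \<eta>" "0 \<le> \<eta>"
  shows "\<bar>expectation F\<bar> \<le> \<eta> + prob B"
proof -
  have int: "integrable M F"
    by (rule integrable_const_bound[where B = 1]) (use assms in auto)
  have int_B: "integrable M (indicator B :: 'a \<Rightarrow> real)"
    by (rule integrable_const_bound[where B = 1]) auto
  have "\<bar>expectation F\<bar> \<le> expectation (\<lambda>x. \<bar>F x\<bar>)"
    by (rule integral_abs_bound)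
  also have "\<dots> \<le> expectation (\<lambda>x. \<eta> + indicator B x)"
  proof (rule integral_mono)
    show "\<bar>F x\<bar> \<le> \<eta> + indicator B x" if "x \<in> space M" for x
      using assms(3,4)[OF that] assms(5) by (cases "x \<in> B") auto
  qed (use int int_B in auto)
  also have "\<dots> = \<eta> + prob B"
    using int_B by (simp add: prob_space)
  finally show ?thesis .
qed

text \<open>Independence read off the product measure, by padding with the factor 1 outside J.
  Singletons and pairs give the second moments in \<open>chebyshev_noise\<close>.\<close>

lemma integral_noise_prod:
  fixes g :: "nat \<Rightarrow> real \<Rightarrow> real"
  assumes "J \<subseteq> {1..n}" "\<And>k. k \<in> J \<Longrightarrow> integrable std_normal_distribution (g k)"
  shows "(LINT \<epsilon>|noise n. (\<Prod>k\<in>J. g k (\<epsilon> k))) = (\<Prod>k\<in>J. LINT x|std_normal_distribution. g k x)"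
    and "integrable (noise n) (\<lambda>\<epsilon>. \<Prod>k\<in>J. g k (\<epsilon> k))"
proof -
  interpret product_sigma_finite "\<lambda>_::nat. std_normal_distribution"
    by unfold_locales
  let ?g = "\<lambda>k x. if k \<in> J then g k x else 1"
  have int: "integrable std_normal_distribution (?g k)" for k
    using assms(2) by (cases "k \<in> J") auto
  have prod: "(\<Prod>k\<in>{1..n}. h k) = (\<Prod>k\<in>J. h k)" if "\<And>k. k \<notin> J \<Longrightarrow> h k = 1" for h :: "nat \<Rightarrow> real"
    using assms(1) that by (intro prod.mono_neutral_right) auto
  have eq: "(\<Prod>k\<in>{1..n}. ?g k (\<epsilon> k)) = (\<Prod>k\<in>J. g k (\<epsilon> k))" for \<epsilon>
    by (subst prod) auto
  have "(LINT \<epsilon>|noise n. (\<Prod>k\<in>{1..n}. ?g k (\<epsilon> k))) = (\<Prod>k\<in>{1..n}. LINT x|std_normal_distribution. ?g k x)"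
    unfolding noise_def using int by (intro product_integral_prod) auto
  also have "\<dots> = (\<Prod>k\<in>J. LINT x|std_normal_distribution. ?g k x)"
    by (rule prod) (simp add: std_normal.prob_space[unfolded std_normal.space_eq_univ])
  finally show "(LINT \<epsilon>|noise n. (\<Prod>k\<in>J. g k (\<epsilon> k))) = (\<Prod>k\<in>J. LINT x|std_normal_distribution. g k x)"
    by (simp only: eq) simp
  have "integrable (noise n) (\<lambda>\<epsilon>. \<Prod>k\<in>{1..n}. ?g k (\<epsilon> k))"
    unfolding noise_def using int by (intro product_integrable_prod) auto
  then show "integrable (noise n) (\<lambda>\<epsilon>. \<Prod>k\<in>J. g k (\<epsilon> k))"
    by (simp only: eq)
qed

text \<open>The bound C only secures integrability; the estimate itself sees the second moment v.
  This matters for the capped score, whose second moment is far below the square of its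
  maximum.\<close>

lemma chebyshev_noise:
  fixes f :: "real \<Rightarrow> real" and v :: real
  assumes [measurable]: "f \<in> borel_measurable borel" and bound: "\<And>x. \<bar>f x\<bar> \<le> C"
    and I: "I \<subseteq> {1..n}" and "0 < a"
    and second: "(LINT x|std_normal_distribution. (f x)\<^sup>2) \<le> v"
  shows "measure (noise n) {\<epsilon> \<in> space (noise n).
      a \<le> \<bar>(\<Sum>i\<in>I. f (\<epsilon> i)) - card I * (LINT x|std_normal_distribution. f x)\<bar>} \<le> card I * v / a\<^sup>2"
    and "{\<epsilon> \<in> space (noise n). a \<le> \<bar>(\<Sum>i\<in>I. f (\<epsilon> i)) -
      card I * (LINT x|std_normal_distribution. f x)\<bar>} \<in> sets (noise n)"
proof -
  interpret P: prob_space "noise n"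
    by (rule prob_space_noise)
  define \<mu> where "\<mu> = (LINT x|std_normal_distribution. f x)"
  define h where "h = (\<lambda>x. f x - \<mu>)"
  have fin: "finite I"
    using I finite_subset by blast
  have f_int: "integrable std_normal_distribution f"
    by (rule std_normal.integrable_const_bound[where B = C]) (use bound in auto)
  have "(f x)\<^sup>2 \<le> C\<^sup>2" for x
    using power_mono[OF bound, of x 2] by simp
  then have f2_int: "integrable std_normal_distribution (\<lambda>x. (f x)\<^sup>2)"
    by (intro std_normal.integrable_const_bound[where B = "C\<^sup>2"]) auto
  have h_int: "integrable std_normal_distribution h" "(LINT x|std_normal_distribution. h x) = 0"
    using f_int by (auto simp: h_def \<mu>_def std_normal.prob_space[unfolded std_normal.space_eq_univ])
  have h2_int: "integrable std_normal_distribution (\<lambda>x. (h x)\<^sup>2)"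
    using f_int f2_int by (simp add: h_def power2_diff)
  have "(LINT x|std_normal_distribution. (h x)\<^sup>2) = (LINT x|std_normal_distribution. (f x)\<^sup>2) - \<mu>\<^sup>2"
    using std_normal.variance_eq[OF f_int f2_int] by (simp add: h_def \<mu>_def)
  then have h2: "(LINT x|std_normal_distribution. (h x)\<^sup>2) \<le> v"
    using second by (smt (verit) zero_le_power2)
  have cross: "(LINT \<epsilon>|noise n. h (\<epsilon> i) * h (\<epsilon> j)) \<le> (if i = j then v else 0)"
      "integrable (noise n) (\<lambda>\<epsilon>. h (\<epsilon> i) * h (\<epsilon> j))" if "i \<in> I" "j \<in> I" for i j
  proof -
    have ij: "i \<in> {1..n}" "j \<in> {1..n}"
      using that I by auto
    have "(LINT \<epsilon>|noise n. h (\<epsilon> i) * h (\<epsilon> j)) \<le> (if i = j then v else 0) \<and>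
        integrable (noise n) (\<lambda>\<epsilon>. h (\<epsilon> i) * h (\<epsilon> j))"
    proof (cases "i = j")
      case True
      then show ?thesis
        using integral_noise_prod[of "{i}" n "\<lambda>_ x. (h x)\<^sup>2"] ij h2_int h2
        by (simp add: power2_eq_square)
    next
      case False
      then show ?thesis
        using integral_noise_prod[of "{i, j}" n "\<lambda>_. h"] ij h_int by simp
    qed
    then show "(LINT \<epsilon>|noise n. h (\<epsilon> i) * h (\<epsilon> j)) \<le> (if i = j then v else 0)"
        "integrable (noise n) (\<lambda>\<epsilon>. h (\<epsilon> i) * h (\<epsilon> j))"
      by auto
  qed
  have sq: "(\<Sum>i\<in>I. h (\<epsilon> i))\<^sup>2 = (\<Sum>i\<in>I. \<Sum>j\<in>I. h (\<epsilon> i) * h (\<epsilon> j))" for \<epsilon>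
    by (simp add: power2_eq_square sum_product)
  have "(LINT \<epsilon>|noise n. (\<Sum>i\<in>I. h (\<epsilon> i))\<^sup>2) = (\<Sum>i\<in>I. \<Sum>j\<in>I. LINT \<epsilon>|noise n. h (\<epsilon> i) * h (\<epsilon> j))"
    unfolding sq using cross(2) by (simp add: integral_sum)
  also have "\<dots> \<le> (\<Sum>i\<in>I. \<Sum>j\<in>I. if i = j then v else 0)"
    using cross(1) by (intro sum_mono)
  also have "\<dots> = card I * v"
    using fin by simp
  finally have var: "(LINT \<epsilon>|noise n. (\<Sum>i\<in>I. h (\<epsilon> i))\<^sup>2) \<le> card I * v" .
  have [measurable]: "h \<in> borel_measurable borel"
    by (simp add: h_def)
  have comp: "(\<lambda>\<epsilon>. \<epsilon> i) \<in> borel_measurable (noise n)" if "i \<in> I" for i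
    unfolding measurable_cong_sets[OF sets_noise refl]
    using I that by (intro measurable_component_singleton) auto
  have "measure (noise n) {\<epsilon> \<in> space (noise n). a \<le> \<bar>\<Sum>i\<in>I. h (\<epsilon> i)\<bar>} \<le>
      (LINT \<epsilon>|noise n. (\<Sum>i\<in>I. h (\<epsilon> i))\<^sup>2) / a\<^sup>2"
  proof (rule P.second_moment_method)
    show "(\<lambda>\<epsilon>. \<Sum>i\<in>I. h (\<epsilon> i)) \<in> borel_measurable (noise n)"
      using comp by (intro borel_measurable_sum) auto
    show "integrable (noise n) (\<lambda>\<epsilon>. (\<Sum>i\<in>I. h (\<epsilon> i))\<^sup>2)"
      unfolding sq using cross(2) by (intro Bochner_Integration.integrable_sum)
  qed (use \<open>0 < a\<close> in auto)
  also have "\<dots> \<le> card I * v / a\<^sup>2"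
    using var by (intro divide_right_mono) auto
  finally show "measure (noise n) {\<epsilon> \<in> space (noise n).
      a \<le> \<bar>(\<Sum>i\<in>I. f (\<epsilon> i)) - card I * (LINT x|std_normal_distribution. f x)\<bar>} \<le> card I * v / a\<^sup>2"
    by (simp add: h_def sum_subtractf \<mu>_def)
  have [measurable]: "(\<lambda>\<epsilon>. \<Sum>i\<in>I. f (\<epsilon> i)) \<in> borel_measurable (noise n)"
    using comp by (intro borel_measurable_sum) auto
  show "{\<epsilon> \<in> space (noise n). a \<le> \<bar>(\<Sum>i\<in>I. f (\<epsilon> i)) -
      card I * (LINT x|std_normal_distribution. f x)\<bar>} \<in> sets (noise n)"
    by measurable
qed

lemma chebyshev_exceedances:
  assumes I: "I \<subseteq> {1..n}" and "0 < a"
  shows "measure (noise n) {\<epsilon> \<in> space (noise n).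
      a \<le> \<bar>real (card {i\<in>I. z < \<bar>\<epsilon> i\<bar>}) - card I * normal_tail z\<bar>} \<le> card I * normal_tail z / a\<^sup>2"
    and "{\<epsilon> \<in> space (noise n).
      a \<le> \<bar>real (card {i\<in>I. z < \<bar>\<epsilon> i\<bar>}) - card I * normal_tail z\<bar>} \<in> sets (noise n)"
proof -
  let ?f = "indicator {x. z < \<bar>x\<bar>} :: real \<Rightarrow> real"
  have fin: "finite I"
    using I finite_subset by blast
  have tail: "(LINT x|std_normal_distribution. ?f x) = normal_tail z"
    by (simp add: normal_tail_def)
  have "(\<lambda>x. (?f x)\<^sup>2) = ?f"
    by (auto simp: indicator_def)
  then have second: "(LINT x|std_normal_distribution. (?f x)\<^sup>2) \<le> normal_tail z"
    using tail by simp
  have card: "(\<Sum>i\<in>I. ?f (\<epsilon> i)) = real (card {i\<in>I. z < \<bar>\<epsilon> i\<bar>})" for \<epsilon>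
    using fin by (simp add: indicator_def Int_def)
  note chebyshev = chebyshev_noise[where f = ?f and C = 1 and I = I and n = n and a = a and v = "normal_tail z",
      OF _ _ I \<open>0 < a\<close> second, unfolded tail card]
  show "measure (noise n) {\<epsilon> \<in> space (noise n).
      a \<le> \<bar>real (card {i\<in>I. z < \<bar>\<epsilon> i\<bar>}) - card I * normal_tail z\<bar>} \<le> card I * normal_tail z / a\<^sup>2"
    by (rule chebyshev(1)) (auto simp: indicator_def)
  show "{\<epsilon> \<in> space (noise n).
      a \<le> \<bar>real (card {i\<in>I. z < \<bar>\<epsilon> i\<bar>}) - card I * normal_tail z\<bar>} \<in> sets (noise n)"
    by (rule chebyshev(2)) (auto simp: indicator_def)
qed

section \<open>Deterministic bounds on the weight and on the rejected set\<close>

text \<open>On the nulls, the score summand at \<open>x\<close> is bounded by \<open>likelihood_ratio x - 1\<close> and by \<open>1 / w\<close>.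
  Taking the first bound below \<open>\<zeta>\<close> and the second above keeps the summands bounded and makes the
  expectation explicit, because \<open>- x * slab_marginal x\<close> is an antiderivative of
  \<open>slab_marginal - std_normal_density\<close>.\<close>

definition capped_score :: "real \<Rightarrow> real \<Rightarrow> real \<Rightarrow> real" where
  "capped_score w \<zeta> x = (if \<bar>x\<bar> \<le> \<zeta> then likelihood_ratio x - 1 else 1 / w)"

lemma capped_score_measurable [measurable]: "capped_score w \<zeta> \<in> borel_measurable borel"
  unfolding capped_score_def by measurable

lemma score_summand_le:
  assumes "0 < w" "w \<le> 1"
  shows "(likelihood_ratio x - 1) / (1 + w * (likelihood_ratio x - 1)) \<le> 1 / w"
    and "(likelihood_ratio x - 1) / (1 + w * (likelihood_ratio x - 1)) \<le> likelihood_ratio x - 1"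
proof -
  let ?b = "likelihood_ratio x - 1"
  have pos: "0 < 1 + w * ?b"
    using assms by (intro mixture_pos) auto
  show "?b / (1 + w * ?b) \<le> 1 / w"
    using pos assms by (simp add: divide_simps algebra_simps)
  have "b \<le> b * (1 + w * b)" for b
  proof -
    have "0 \<le> w * (b * b)"
      using assms by simp
    then show ?thesis
      by (simp add: algebra_simps)
  qed
  then show "?b / (1 + w * ?b) \<le> ?b"
    using pos by (simp add: divide_simps)
qed

text \<open>I will be the set of nulls. The signals are charged the worst case 1/w each, which
  requires no upper bound on their size.\<close>

lemma score_le_capped:
  assumes "0 < w" "w \<le> 1" "I \<subseteq> {1..n}"
  shows "score n X w \<le> real (card ({1..n} - I)) / w + (\<Sum>i\<in>I. capped_score w \<zeta> (X i))"
proof -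
  let ?f = "\<lambda>i. (likelihood_ratio (X i) - 1) / (1 + w * (likelihood_ratio (X i) - 1))"
  have "score n X w = (\<Sum>i\<in>{1..n} - I. ?f i) + (\<Sum>i\<in>I. ?f i)"
    unfolding score_def using assms by (intro sum.subset_diff) auto
  also have "(\<Sum>i\<in>{1..n} - I. ?f i) \<le> real (card ({1..n} - I)) * (1 / w)"
    using score_summand_le(1)[OF assms(1,2)] by (intro sum_bounded_above) auto
  also have "(\<Sum>i\<in>I. ?f i) \<le> (\<Sum>i\<in>I. capped_score w \<zeta> (X i))"
    using score_summand_le[OF assms(1,2)] by (intro sum_mono) (auto simp: capped_score_def)
  finally show ?thesis
    by simp
qed

lemma integral_capped_score:
  assumes "0 \<le> \<zeta>" "0 < w"
  shows "(LINT x|std_normal_distribution. capped_score w \<zeta> x) =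
      - 2 * \<zeta> * slab_marginal \<zeta> + normal_tail \<zeta> / w"
    and "\<And>B. 1 \<le> B \<Longrightarrow> likelihood_ratio \<zeta> \<le> B \<Longrightarrow>
      (LINT x|std_normal_distribution. (capped_score w \<zeta> x)\<^sup>2) \<le> B + normal_tail \<zeta> / w\<^sup>2"
proof -
  let ?f = "\<lambda>x. indicator {-\<zeta>..\<zeta>} x * (likelihood_ratio x - 1)"
  let ?g = "indicator {x. \<zeta> < \<bar>x\<bar>} :: real \<Rightarrow> real"
  have f_bound: "\<bar>?f x\<bar> \<le> likelihood_ratio \<zeta> + 1" for x
  proof (cases "x \<in> {-\<zeta>..\<zeta>}")
    case True
    then have "\<bar>x\<bar> \<le> \<bar>\<zeta>\<bar>"
      by auto
    then show ?thesis
      using True likelihood_ratio_ge_half[of x] likelihood_ratio_mono[of x \<zeta>] by simp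
  qed (use likelihood_ratio_pos[of \<zeta>] in auto)
  have f_int [simp]: "integrable std_normal_distribution ?f"
    by (rule std_normal.integrable_const_bound[where B = "likelihood_ratio \<zeta> + 1"]) (use f_bound in auto)
  have g_int [simp]: "integrable std_normal_distribution ?g"
    by (rule std_normal.integrable_const_bound[where B = 1]) auto
  have i_int [simp]: "integrable std_normal_distribution (indicator {-\<zeta>..\<zeta>} :: real \<Rightarrow> real)"
    by (rule std_normal.integrable_const_bound[where B = 1]) auto
  have tail: "(LINT x|std_normal_distribution. ?g x) = normal_tail \<zeta>"
    by (simp add: normal_tail_def)
  have eq: "capped_score w \<zeta> x = ?f x + 1 / w * ?g x" for x
    by (auto simp: capped_score_def indicator_def)
  show "(LINT x|std_normal_distribution. capped_score w \<zeta> x) =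
      - 2 * \<zeta> * slab_marginal \<zeta> + normal_tail \<zeta> / w"
    unfolding eq using assms integral_truncated_likelihood_ratio[of \<zeta>] tail
    by (subst Bochner_Integration.integral_add) auto
  fix B assume B: "1 \<le> B" "likelihood_ratio \<zeta> \<le> B"
  \<comment> \<open>Of the two factors rho in the square only one is replaced by its maximum B; the
    other is integrated and has integral at most 1 over the interval. This yields B in place of B^2.
    The sum of \<open>?f x\<close> and the indicator is the truncated rho.\<close>
  have sq: "(capped_score w \<zeta> x)\<^sup>2 \<le> B * (?f x + indicator {-\<zeta>..\<zeta>} x) + 1 / w\<^sup>2 * ?g x" for x
  proof (cases "\<bar>x\<bar> \<le> \<zeta>")
    case True
    have lr: "1 / 2 \<le> likelihood_ratio x" "likelihood_ratio x \<le> B"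
      using True B likelihood_ratio_ge_half[of x] likelihood_ratio_mono[of x \<zeta>] by auto
    \<comment> \<open>The first alternative amounts to 1 <= 2 rho, that is, to
      \<open>likelihood_ratio_ge_half\<close>.\<close>
    have "(likelihood_ratio x - 1)\<^sup>2 \<le> likelihood_ratio x * likelihood_ratio x \<or>
        (likelihood_ratio x - 1)\<^sup>2 \<le> 1 * likelihood_ratio x"
      using lr by (auto simp: power2_eq_square algebra_simps)
    then have "(likelihood_ratio x - 1)\<^sup>2 \<le> B * likelihood_ratio x"
      using lr B mult_right_mono[of "likelihood_ratio x" B "likelihood_ratio x"]
        mult_right_mono[of 1 B "likelihood_ratio x"] by linarith
    moreover have "x \<in> {-\<zeta>..\<zeta>}" "\<not> \<zeta> < \<bar>x\<bar>"
      using True by auto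
    ultimately show ?thesis
      using True by (simp add: capped_score_def)
  next
    case False
    then show ?thesis
      by (auto simp: capped_score_def indicator_def power_divide)
  qed
  have "(LINT x|std_normal_distribution. (capped_score w \<zeta> x)\<^sup>2) \<le>
      (LINT x|std_normal_distribution. B * (?f x + indicator {-\<zeta>..\<zeta>} x) + 1 / w\<^sup>2 * ?g x)"
    by (rule integral_mono'[OF _ sq order_trans[OF zero_le_power2 sq]]) simp
  also have "\<dots> = B * ((LINT x|std_normal_distribution. ?f x) + measure std_normal_distribution {-\<zeta>..\<zeta>})
      + normal_tail \<zeta> / w\<^sup>2"
    using tail by simp
  also have "\<dots> \<le> B * (0 + 1) + normal_tail \<zeta> / w\<^sup>2"
    using B assms likelihood_ratio_pos[of \<zeta>]
    by (intro add_right_mono mult_left_mono add_mono)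
       (auto simp: integral_truncated_likelihood_ratio mult_nonneg_nonneg
         simp flip: std_normal_density_times_likelihood_ratio intro: less_imp_le[OF std_normal_density_positive])
  finally show "(LINT x|std_normal_distribution. (capped_score w \<zeta> x)\<^sup>2) \<le> B + normal_tail \<zeta> / w\<^sup>2"
    by simp
qed

text \<open>At w = s/(4n) each index in G has w (rho - 1) >= 1 and so contributes at least 1/(2w) =
  2n/s to the score; the at least s/2 of them contribute n. The fewer than n other indices
  contribute at least -1 each. The hypothesis 4 <= s puts this w into the range of the
  maximization.\<close>

lemma w_hat_ge_of_strong_signals:
  assumes "4 \<le> s" "s \<le> n" "G \<subseteq> {1..n}" "real s \<le> 2 * card G"
    and lr: "\<And>i. i \<in> G \<Longrightarrow> 4 * real n / real s \<le> likelihood_ratio (X i) - 1"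
  shows "real s / (4 * real n) \<le> w_hat n X"
proof -
  define w where "w = real s / (4 * real n)"
  let ?b = "\<lambda>i. likelihood_ratio (X i) - 1"
  have n: "0 < real n" "0 < real s"
    using assms by auto
  have w: "0 < w" "w \<le> 1" "1 / real n \<le> w"
    using assms n by (auto simp: w_def field_simps)
  have fin: "finite G"
    using assms finite_subset by blast
  have strong: "2 * n / s \<le> ?b i / (1 + w * ?b i)" if "i \<in> G" for i
  proof -
    have "w * (4 * real n / real s) \<le> w * ?b i"
      using lr[OF that] w by (intro mult_left_mono) auto
    then have "1 \<le> w * ?b i"
      using n by (simp add: w_def)
    then have "1 / (2 * w) \<le> ?b i / (1 + w * ?b i)"
      using w by (simp add: divide_simps)
    then show ?thesis
      using n by (simp add: w_def)
  qed
  have weak: "-1 \<le> ?b i / (1 + w * ?b i)" for i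
  proof -
    have "0 < 1 + w * ?b i"
      using w by (intro mixture_pos) auto
    moreover have "(1 + w) * (1 / 2) \<le> (1 + w) * likelihood_ratio (X i)"
      using w likelihood_ratio_ge_half by (intro mult_left_mono) auto
    ultimately show ?thesis
      using w by (simp add: divide_simps algebra_simps)
  qed
  have "real n \<le> card G * (2 * n / s)"
    using assms(4) n by (simp add: divide_simps)
  also have "\<dots> \<le> (\<Sum>i\<in>G. ?b i / (1 + w * ?b i))"
    using strong by (intro sum_bounded_below) auto
  finally have 1: "real n \<le> (\<Sum>i\<in>G. ?b i / (1 + w * ?b i))" .
  have "real (card ({1..n} - G)) * (-1) \<le> (\<Sum>i\<in>{1..n} - G. ?b i / (1 + w * ?b i))"
    using weak by (intro sum_bounded_below) auto
  moreover have "card ({1..n} - G) < n"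
  proof -
    have "G \<noteq> {}"
      using assms by auto
    then have "card ({1..n} - G) < card {1..n}"
      using assms(3) by (intro psubset_card_mono) auto
    then show ?thesis by simp
  qed
  moreover have "score n X w = (\<Sum>i\<in>{1..n} - G. ?b i / (1 + w * ?b i)) + (\<Sum>i\<in>G. ?b i / (1 + w * ?b i))"
    unfolding score_def using assms by (intro sum.subset_diff) auto
  ultimately have "0 < score n X w"
    using 1 by simp
  then have "w \<le> w_hat n X"
    using assms w score_nonzeroD[of n X w] by (intro w_hat_ge) auto
  then show ?thesis
    by (simp add: w_def)
qed

lemma FDP_eq:
  "FDP n d \<theta> = real (card {i\<in>{1..n}. \<theta> i = 0 \<and> d i}) / max 1 (real (card {i\<in>{1..n}. d i}))"
  unfolding FDP_def by (simp add: Int_def)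

text \<open>The first two conditions in \<open>num\<close> are the signs of the two threshold sums,
  divided by s. At z2 the nulls give at least (1 - \<delta> - t) l2 - \<delta> and the signals at
  least -t. At z1 the nulls give at most (1 - t) u1, the indices in G at most (1 -
  \<delta>)(\<delta> - t), and the remaining signals at most \<delta>. With V false and R true
  rejections, V is then between l1 s and u2 s and R between (1 - \<delta>) s and s, which bounds
  V/(V + R).\<close>

lemma threshold_sandwich:
  fixes X \<theta> :: "nat \<Rightarrow> real" and n s :: nat and N :: "real \<Rightarrow> real"
    and t \<delta> w z1 z2 l1 u1 l2 u2 \<zeta> :: real
  defines "w \<equiv> w_hat n X"
    and "N \<equiv> \<lambda>z. real (card {i\<in>{1..n}. \<theta> i = 0 \<and> z < \<bar>X i\<bar>})"
    and "S \<equiv> {i\<in>{1..n}. \<theta> i \<noteq> 0}"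
  assumes "1 \<le> n" "1 \<le> s" "0 < t" "t < 1" "0 < \<delta>" "\<delta> \<le> t" "\<delta> + t \<le> 1" "w < 1" "card S = s"
    and G: "G \<subseteq> S" "(1 - \<delta>) * s \<le> card G" "\<And>i. i \<in> G \<Longrightarrow> z1 < \<bar>X i\<bar>"
      "\<And>i. i \<in> G \<Longrightarrow> ell_value w (X i) \<le> \<delta>"
    and N: "l1 * s \<le> N z1" "N z1 \<le> u1 * s" "l2 * s \<le> N z2" "N z2 \<le> u2 * s" "N \<zeta> \<le> \<delta> * s"
    and null: "\<And>x. \<bar>x\<bar> \<le> \<zeta> \<Longrightarrow> 1 - \<delta> \<le> ell_value w x"
    and num: "\<delta> + t < (1 - \<delta> - t) * l2" "(1 - t) * u1 + (1 - \<delta>) * (\<delta> - t) + \<delta> \<le> 0" "0 \<le> l1" "0 \<le> u2"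
  shows "l1 / (l1 + 1) \<le> FDP n (cumulative_ell n t X) \<theta>"
    and "FDP n (cumulative_ell n t X) \<theta> \<le> u2 / (u2 + 1 - \<delta>)"
    and "(\<Sum>i\<in>{1..n}. of_bool (\<theta> i \<noteq> 0 \<and> \<not> cumulative_ell n t X i)) /
      max 1 (\<Sum>i\<in>{1..n}. of_bool (\<theta> i \<noteq> 0)) \<le> \<delta>"
proof -
  let ?e = "\<lambda>j. ell_value w (X j)"
  let ?c = "cumulative_ell n t X"
  have w: "0 < w" "w \<le> 1"
    using w_hat_pos[OF \<open>1 \<le> n\<close>, of X] \<open>w < 1\<close> by (auto simp: w_def)
  have e: "0 \<le> ?e j" "?e j < 1" for j
    using w by (auto simp: ell_value_nonneg ell_value_less_1)
  have finS: "finite S"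
    by (simp add: S_def)
  have finG: "finite G"
    using G(1) finS finite_subset by blast
  have \<delta>1: "\<delta> < 1"
    using assms by linarith
  have s: "0 < real s"
    using \<open>1 \<le> s\<close> by simp
  have split: "(\<Sum>j\<in>{j\<in>{1..n}. z < \<bar>X j\<bar>}. ?e j - t) =
      (\<Sum>j\<in>{j\<in>{1..n}. \<theta> j = 0 \<and> z < \<bar>X j\<bar>}. ?e j - t) + (\<Sum>j\<in>{j\<in>S. z < \<bar>X j\<bar>}. ?e j - t)" for z
    unfolding S_def by (subst sum.union_disjoint[symmetric]) (auto intro: sum.cong)
  have card_le_s: "card {j\<in>S. P j} \<le> s" for P
    using card_mono[OF finS, of "{j\<in>S. P j}"] \<open>card S = s\<close> by auto
  have upper: "0 < (\<Sum>j\<in>{j\<in>{1..n}. z2 < \<bar>X j\<bar>}. ?e j - t)"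
  proof -
    let ?A = "{j\<in>{1..n}. \<theta> j = 0 \<and> z2 < \<bar>X j\<bar>}"
    have "(1 - \<delta> - t) * (l2 * s) \<le> (1 - \<delta> - t) * N z2"
      using N assms by (intro mult_left_mono) auto
    then have "(1 - \<delta> - t) * l2 * s - \<delta> * s \<le> (1 - \<delta> - t) * N z2 - N \<zeta>"
      using N by simp
    \<comment> \<open>Nulls beyond \<zeta> have no lower bound on their l-value except 0, so each of
      them is charged an extra 1.\<close>
    also have "\<dots> \<le> (\<Sum>j\<in>?A. 1 - \<delta> - t) - (\<Sum>j\<in>{j\<in>?A. \<zeta> < \<bar>X j\<bar>}. 1)"
      by (simp add: N_def) (intro card_mono, auto)
    also have "(\<Sum>j\<in>{j\<in>?A. \<zeta> < \<bar>X j\<bar>}. 1) = (\<Sum>j\<in>?A. if \<zeta> < \<bar>X j\<bar> then 1 else 0)"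
      by (rule sum.inter_filter) simp
    also have "(\<Sum>j\<in>?A. 1 - \<delta> - t) - \<dots> = (\<Sum>j\<in>?A. 1 - \<delta> - t - (if \<zeta> < \<bar>X j\<bar> then 1 else 0))"
      by (rule sum_subtractf[symmetric])
    also have "\<dots> \<le> (\<Sum>j\<in>?A. ?e j - t)"
    proof (rule sum_mono)
      fix j
      show "1 - \<delta> - t - (if \<zeta> < \<bar>X j\<bar> then 1 else 0) \<le> ?e j - t"
        using null[of "X j"] e(1)[of j] \<open>0 < \<delta>\<close> by auto
    qed
    finally have 1: "(1 - \<delta> - t) * l2 * s - \<delta> * s \<le> (\<Sum>j\<in>?A. ?e j - t)" .
    have "- t * s \<le> card {j\<in>S. z2 < \<bar>X j\<bar>} * (- t)"
      using card_le_s[of "\<lambda>j. z2 < \<bar>X j\<bar>"] \<open>0 < t\<close> by (simp add: mult.commute)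
    also have "\<dots> \<le> (\<Sum>j\<in>{j\<in>S. z2 < \<bar>X j\<bar>}. ?e j - t)"
      using e by (intro sum_bounded_below) auto
    finally have 2: "- t * s \<le> (\<Sum>j\<in>{j\<in>S. z2 < \<bar>X j\<bar>}. ?e j - t)" .
    have "(\<delta> + t) * s < (1 - \<delta> - t) * l2 * s"
      using num s by (intro mult_strict_right_mono) auto
    then show ?thesis
      unfolding split using 1 2 by (simp add: algebra_simps)
  qed
  have lower: "(\<Sum>j\<in>{j\<in>{1..n}. z1 < \<bar>X j\<bar>}. ?e j - t) \<le> 0"
  proof -
    let ?A = "{j\<in>{1..n}. \<theta> j = 0 \<and> z1 < \<bar>X j\<bar>}"
    let ?B = "{j\<in>S. z1 < \<bar>X j\<bar>}"
    have "(\<Sum>j\<in>?A. ?e j - t) \<le> real (card ?A) * (1 - t)"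
      using e by (intro sum_bounded_above) (auto intro: less_imp_le)
    also have "\<dots> \<le> u1 * s * (1 - t)"
      using N(2) \<open>t < 1\<close> by (intro mult_right_mono) (auto simp: N_def)
    finally have 1: "(\<Sum>j\<in>?A. ?e j - t) \<le> u1 * s * (1 - t)" .
    have "(\<Sum>j\<in>G. ?e j - t) \<le> card G * (\<delta> - t)"
      using G by (intro sum_bounded_above) auto
    also have "\<dots> \<le> (1 - \<delta>) * s * (\<delta> - t)"
      using G(2) \<open>\<delta> \<le> t\<close> by (intro mult_right_mono_neg) auto
    finally have 2: "(\<Sum>j\<in>G. ?e j - t) \<le> (1 - \<delta>) * s * (\<delta> - t)" .
    have "(\<Sum>j\<in>?B - G. ?e j - t) \<le> card (?B - G) * (1 :: real)"
      using e \<open>0 < t\<close> by (intro sum_bounded_above) (smt (verit))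
    also have "real (card (?B - G)) \<le> real (card (S - G))"
      using finS by (intro of_nat_mono card_mono) auto
    also have "real (card (S - G)) = real s - real (card G)"
      using G(1) finG card_mono[OF finS G(1)] \<open>card S = s\<close> by (simp add: card_Diff_subset of_nat_diff)
    also have "\<dots> \<le> \<delta> * s"
      using G(2) by (simp add: algebra_simps)
    finally have 3: "(\<Sum>j\<in>?B - G. ?e j - t) \<le> \<delta> * s"
      by simp
    have 4: "(\<Sum>j\<in>?B. ?e j - t) = (\<Sum>j\<in>?B - G. ?e j - t) + (\<Sum>j\<in>G. ?e j - t)"
      using finS G by (intro sum.subset_diff) auto
    have "((1 - t) * u1 + (1 - \<delta>) * (\<delta> - t) + \<delta>) * s \<le> 0"
      using num s by (intro mult_nonpos_nonneg) auto
    then show ?thesis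
      unfolding split 4 using 1 2 3 by (simp add: algebra_simps)
  qed
  have rej1: "?c i" if "i \<in> {1..n}" "z1 < \<bar>X i\<bar>" for i
    by (rule cumulative_ellI[OF \<open>1 \<le> n\<close> less_imp_le[OF \<open>0 < t\<close>] that(1)
          \<open>w < 1\<close>[unfolded w_def] lower[unfolded w_def] that(2)])
  have rej2: "z2 < \<bar>X i\<bar>" if "i \<in> {1..n}" "?c i" for i
    by (rule cumulative_ell_imp_gt[OF \<open>1 \<le> n\<close> less_imp_le[OF \<open>0 < t\<close>] that(1)
          upper[unfolded w_def] that(2)])
  define V where "V = real (card {i\<in>{1..n}. \<theta> i = 0 \<and> ?c i})"
  define R where "R = real (card {i\<in>S. ?c i})"
  have "N z1 \<le> V"
    unfolding N_def V_def using rej1 by (intro of_nat_mono card_mono) auto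
  then have V1: "l1 * s \<le> V"
    using N by simp
  have "V \<le> N z2"
    unfolding N_def V_def using rej2 by (intro of_nat_mono card_mono) auto
  then have V2: "V \<le> u2 * s"
    using N by simp
  have "real (card G) \<le> R"
    unfolding R_def using rej1 G finS by (intro of_nat_mono card_mono) (auto simp: S_def)
  then have R1: "(1 - \<delta>) * s \<le> R"
    using G by simp
  have R2: "R \<le> s"
    unfolding R_def using card_le_s by simp
  have V0: "0 \<le> V"
    by (simp add: V_def)
  have "0 < (1 - \<delta>) * s"
    using \<delta>1 s by simp
  then have Rpos: "0 < R"
    using R1 by linarith
  then have "1 \<le> R"
    unfolding R_def by (metis Suc_le_eq of_nat_0_less_iff of_nat_1 of_nat_le_iff One_nat_def)
  have "{i\<in>{1..n}. ?c i} = {i\<in>{1..n}. \<theta> i = 0 \<and> ?c i} \<union> {i\<in>S. ?c i}"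
    by (auto simp: S_def)
  then have "real (card {i\<in>{1..n}. ?c i}) = V + R"
    unfolding V_def R_def by (subst of_nat_add[symmetric], subst card_Un_disjoint[symmetric]) (auto simp: S_def)
  then have FDP: "FDP n ?c \<theta> = V / (V + R)"
    unfolding FDP_eq V_def[symmetric] using \<open>1 \<le> R\<close> V0 by simp
  have "l1 * R \<le> l1 * s"
    using R2 num by (intro mult_left_mono) auto
  then have "l1 * R \<le> V"
    using V1 by simp
  then show "l1 / (l1 + 1) \<le> FDP n ?c \<theta>"
    unfolding FDP using num V0 Rpos by (simp add: divide_simps algebra_simps)
  have "V * (1 - \<delta>) \<le> u2 * s * (1 - \<delta>)"
    using V2 \<delta>1 by (intro mult_right_mono) auto
  also have "\<dots> = u2 * ((1 - \<delta>) * s)"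
    by simp
  also have "\<dots> \<le> u2 * R"
    using R1 num by (intro mult_left_mono) auto
  finally show "FDP n ?c \<theta> \<le> u2 / (u2 + 1 - \<delta>)"
    unfolding FDP using num V0 Rpos \<delta>1 by (simp add: divide_simps algebra_simps)
  have "{i\<in>S. \<not> ?c i} = S - {i\<in>S. ?c i}"
    by auto
  then have "real (card {i\<in>S. \<not> ?c i}) = s - R"
    using finS \<open>card S = s\<close> card_le_s by (simp add: card_Diff_subset of_nat_diff R_def)
  then have "real (card {i\<in>S. \<not> ?c i}) \<le> \<delta> * s"
    using R1 by (simp add: algebra_simps)
  moreover have "(\<Sum>i\<in>{1..n}. of_bool (\<theta> i \<noteq> 0 \<and> \<not> ?c i)) = real (card {i\<in>S. \<not> ?c i})"
    by (simp add: Int_def S_def conj_assoc)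
  moreover have "(\<Sum>i\<in>{1..n}. of_bool (\<theta> i \<noteq> 0)) = real s"
    using \<open>card S = s\<close> by (simp add: Int_def S_def)
  ultimately show "(\<Sum>i\<in>{1..n}. of_bool (\<theta> i \<noteq> 0 \<and> \<not> ?c i)) /
      max 1 (\<Sum>i\<in>{1..n}. of_bool (\<theta> i \<noteq> 0)) \<le> \<delta>"
    using s \<open>1 \<le> s\<close> by (simp add: divide_simps)
qed

section \<open>A quantitative bound for fixed \<open>n\<close>\<close>

text \<open>Here \<open>\<zeta> = sqrt (2 * ln (n / s))\<close>, signals exceed \<open>\<zeta> + 2 * u\<close> in absolute value, and \<open>c1 < t / (1 - t) < c2\<close>
  are the numbers of false rejections, in units of \<open>s\<close>, at the thresholds \<open>z1\<close> and \<open>z2\<close>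
  bracketing the data-driven one.\<close>

locale sparse_regime =
  fixes n s :: nat and t \<delta> \<eta> c1 c2 \<zeta> u :: real
  assumes sparsity: "4 \<le> s" "s < n"
    and level: "0 < t" "t < 1" "0 < \<delta>" "\<delta> \<le> t" "\<delta> + t \<le> 1" "\<delta> \<le> \<eta>"
    and \<zeta>: "1 \<le> \<zeta>" "exp (\<zeta>\<^sup>2 / 2) = real n / real s"
    and u: "0 \<le> u" "normal_tail u \<le> \<delta> / 2"
    and c: "0 < c1" "c1 \<le> c2" "2 * \<delta> \<le> c1" "1 / \<zeta> < c1" "c2 * (real s / real n) \<le> \<delta>"
    and strong: "4 / \<delta> * (real n / real s) \<le> likelihood_ratio (\<zeta> + u) - 1"
    and weight: "4 * (real s / real n) * \<zeta> < 1"
    and null: "1 - \<delta> \<le> (1 - 4 * (real s / real n) * \<zeta>) / (1 + 4 / \<zeta>)" "2 / \<zeta> \<le> \<delta>"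
    and ratio_bound: "real s / real n * \<zeta>\<^sup>2 \<le> 1"
    and score_bound: "3 / 8 < (1 - real s / real n) * (2 / 3 * (1 - real s / real n) - 1 / (4 * \<zeta>))"
    and above: "\<delta> + t < (1 - \<delta> - t) * (c2 - 2 * \<delta>)" "(c2 + \<delta>) / (c2 + \<delta> + 1 - \<delta>) \<le> t + \<eta>"
    and below: "(1 - t) * (c1 + \<delta>) + (1 - \<delta>) * (\<delta> - t) + \<delta> \<le> 0"
      "t - \<eta> \<le> (c1 - 2 * \<delta>) / (c1 - 2 * \<delta> + 1)"
begin

section \<open>Deterministic estimates at the threshold and at the upper weight\<close>

lemma sizes: "0 < real n" "0 < real s" "1 \<le> n" "1 \<le> s" "0 < real s / real n" "real s / real n < 1" "\<delta> \<le> 1 / 2" "0 < \<zeta>"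
  using sparsity level \<zeta> by auto

lemma threshold_eq: "sqrt (2 * ln (real n / real s)) = \<zeta>"
  unfolding \<zeta>(2)[symmetric] using sizes by simp

lemma std_normal_density_threshold: "std_normal_density \<zeta> = real s / real n / sqrt (2 * pi)"
proof -
  have "exp (- \<zeta>\<^sup>2 / 2) = inverse (real n / real s)"
    unfolding \<zeta>(2)[symmetric] by (simp add: exp_minus[symmetric])
  then show ?thesis
    by (simp add: std_normal_density_def)
qed

lemma sqrt_two_pi: "2 \<le> sqrt (2 * pi)" "sqrt (2 * pi) \<le> 3"
  using pi_gt3 pi_less_4 by (auto intro!: real_le_rsqrt real_le_lsqrt)

lemma normal_tail_threshold: "normal_tail \<zeta> \<le> real s / real n / \<zeta>"
proof -
  have "normal_tail \<zeta> \<le> 2 * std_normal_density \<zeta> / \<zeta>"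
    using sizes by (intro mills_ratio_bound) auto
  also have "\<dots> = real s / real n / \<zeta> * (2 / sqrt (2 * pi))"
    by (simp add: std_normal_density_threshold mult_ac)
  also have "\<dots> \<le> real s / real n / \<zeta> * 1"
    using sizes sqrt_two_pi by (intro mult_left_mono) (auto simp: divide_simps)
  finally show ?thesis
    by simp
qed

lemma likelihood_ratio_threshold: "likelihood_ratio \<zeta> = (real n / real s - 1) / \<zeta>\<^sup>2"
  using sizes by (subst likelihood_ratio_eq) (auto simp: \<zeta>(2))

lemma slab_marginal_threshold: "2 / 3 * (1 - real s / real n) / \<zeta> \<le> 2 * \<zeta> * slab_marginal \<zeta>"
proof -
  have "2 * \<zeta> * slab_marginal \<zeta> = 2 / sqrt (2 * pi) * (1 - real s / real n) / \<zeta>"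
    unfolding std_normal_density_times_likelihood_ratio[symmetric] std_normal_density_threshold
      likelihood_ratio_threshold
    using sizes by (simp add: field_simps power2_eq_square)
  moreover have "2 / 3 \<le> 2 / sqrt (2 * pi)"
    using sqrt_two_pi by (intro divide_left_mono) auto
  then have "2 / 3 * (1 - real s / real n) / \<zeta> \<le> 2 / sqrt (2 * pi) * (1 - real s / real n) / \<zeta>"
    using sizes(6,8) by (intro divide_right_mono mult_right_mono) auto
  ultimately show ?thesis
    by simp
qed

text \<open>At this weight s signals add at most s/w = n/(4 \<zeta>) to the score, while the nulls
  subtract nearly (2/3) n/\<zeta>.\<close>

definition w_upper :: real where
  "w_upper = 4 * (real s / real n) * \<zeta>"

lemma w_upper: "0 < w_upper" "w_upper < 1" "1 / real n \<le> w_upper"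
proof -
  show "0 < w_upper" "w_upper < 1"
    using sizes weight by (auto simp: w_upper_def)
  have "1 * 1 \<le> (4 * real s) * \<zeta>"
    using \<zeta> sparsity by (intro mult_mono) auto
  then show "1 / real n \<le> w_upper"
    using sizes by (simp add: w_upper_def divide_simps)
qed

lemma integral_capped_score_le:
  "(LINT x|std_normal_distribution. capped_score w_upper \<zeta> x) \<le>
    - (2 / 3 * (1 - real s / real n) - 1 / (4 * \<zeta>)) / \<zeta>"
proof -
  have "normal_tail \<zeta> / w_upper \<le> real s / real n / \<zeta> / w_upper"
    using w_upper normal_tail_threshold by (intro divide_right_mono) auto
  also have "\<dots> = 1 / (4 * \<zeta>) / \<zeta>"
    using sizes by (simp add: w_upper_def field_simps)
  finally show ?thesis
    using slab_marginal_threshold sizes w_upper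
    by (simp add: integral_capped_score diff_divide_distrib)
qed

text \<open>The \<zeta>^2 in the denominator is essential: against a deviation n/(8 \<zeta>) it
  cancels in Chebyshev's inequality and leaves the bound 128/s.\<close>

lemma integral_capped_score_square_le:
  "(LINT x|std_normal_distribution. (capped_score w_upper \<zeta> x)\<^sup>2) \<le> 2 * (real n / (real s * \<zeta>\<^sup>2))"
proof -
  define B where "B = real n / (real s * \<zeta>\<^sup>2)"
  have "1 \<le> B"
    using ratio_bound sizes by (simp add: B_def field_simps)
  moreover have "likelihood_ratio \<zeta> \<le> B"
    unfolding likelihood_ratio_threshold B_def using sizes by (simp add: field_simps)
  ultimately have "(LINT x|std_normal_distribution. (capped_score w_upper \<zeta> x)\<^sup>2) \<le> B + normal_tail \<zeta> / w_upper\<^sup>2"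
    using sizes w_upper by (intro integral_capped_score(2)) auto
  also have "normal_tail \<zeta> / w_upper\<^sup>2 \<le> real s / real n / \<zeta> / w_upper\<^sup>2"
    using normal_tail_threshold by (intro divide_right_mono) auto
  also have "\<dots> = B * (1 / (16 * \<zeta>))"
    using sizes by (simp add: w_upper_def B_def field_simps power2_eq_square)
  also have "\<dots> \<le> B * 1"
    using \<open>1 \<le> B\<close> \<zeta> by (intro mult_left_mono) auto
  finally show ?thesis
    by (simp add: B_def)
qed

text \<open>The term 8/\<delta>^2 collects two counts with deviation \<delta> s/2 and variance at
  most s, the middle term the counts at z1 and z2, and 128 the score.\<close>

definition failure_bound :: real where
  "failure_bound = (8 / \<delta>\<^sup>2 + (c1 + c2) / \<delta>\<^sup>2 + 128) / s"

definition z1 :: real where "z1 = (SOME z. normal_tail z = c1 * (real s / real n))"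
definition z2 :: real where "z2 = (SOME z. normal_tail z = c2 * (real s / real n))"

lemma normal_tail_z: "normal_tail z1 = c1 * (real s / real n)" "normal_tail z2 = c2 * (real s / real n)"
proof -
  have "\<exists>z. normal_tail z = c' * (real s / real n)" if "0 < c'" "c' \<le> c2" for c'
  proof -
    have "c' * (real s / real n) \<le> c2 * (real s / real n)"
      using that sizes by (intro mult_right_mono) auto
    then have "c' * (real s / real n) < 1"
      using c level by linarith
    then show ?thesis
      using normal_tail_surj[of "c' * (real s / real n)"] that sizes by auto
  qed
  then show "normal_tail z1 = c1 * (real s / real n)" "normal_tail z2 = c2 * (real s / real n)"
    unfolding z1_def z2_def using c(1,2) by (metis (mono_tags, lifting) someI_ex order_refl less_le_trans)+
qed

text \<open>Ensures that every signal observed beyond \<zeta> also lies beyond z1. It holds because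
  c1 > 1/\<zeta> makes the tail at z1 larger than the tail at \<zeta>.\<close>

lemma z1_less: "z1 < \<zeta>"
proof (rule ccontr)
  assume "\<not> z1 < \<zeta>"
  then have "c1 * (real s / real n) \<le> real s / real n / \<zeta>"
    using normal_tail_antimono[of \<zeta> z1] normal_tail_threshold normal_tail_z by simp
  also have "\<dots> = (1 / \<zeta>) * (real s / real n)"
    by simp
  also have "\<dots> < c1 * (real s / real n)"
    using c sizes by (intro mult_strict_right_mono) auto
  finally show False
    by simp
qed

section \<open>The bad event and the error rates for one signal vector\<close>

context
  fixes \<theta> :: "nat \<Rightarrow> real" and v :: real
  assumes \<theta>: "\<theta> \<in> signal_class n s v" and v: "2 * u \<le> v"
begin

definition S :: "nat set" where "S = {i\<in>{1..n}. \<theta> i \<noteq> 0}"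
definition Z :: "nat set" where "Z = {i\<in>{1..n}. \<theta> i = 0}"

lemma SZ: "S \<subseteq> {1..n}" "Z \<subseteq> {1..n}" "card S = s" "real (card Z) = real n - real s" "{1..n} - Z = S"
proof -
  show S: "S \<subseteq> {1..n}" "Z \<subseteq> {1..n}" "card S = s" "{1..n} - Z = S"
    using \<theta> by (auto simp: S_def Z_def signal_class_def)
  have "Z = {1..n} - S"
    by (auto simp: S_def Z_def)
  then show "real (card Z) = real n - real s"
    using S sparsity by (simp add: card_Diff_subset finite_subset of_nat_diff)
qed

text \<open>Deviation \<delta> s/2 is imposed where the mean may itself reach \<delta> s/2, so that
  the count stays below \<delta> s. The deviation n/(8 \<zeta>) is the slack in the sign of the
  score at \<open>w_upper\<close>.\<close>

definition bad :: "(nat \<Rightarrow> real) set" where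
  "bad =
    {\<epsilon>\<in>space (noise n). \<delta> * s / 2 \<le> \<bar>real (card {i\<in>S. u < \<bar>\<epsilon> i\<bar>}) - card S * normal_tail u\<bar>} \<union>
    {\<epsilon>\<in>space (noise n). \<delta> * s \<le> \<bar>real (card {i\<in>Z. z1 < \<bar>\<epsilon> i\<bar>}) - card Z * normal_tail z1\<bar>} \<union>
    {\<epsilon>\<in>space (noise n). \<delta> * s \<le> \<bar>real (card {i\<in>Z. z2 < \<bar>\<epsilon> i\<bar>}) - card Z * normal_tail z2\<bar>} \<union>
    {\<epsilon>\<in>space (noise n). \<delta> * s / 2 \<le> \<bar>real (card {i\<in>Z. \<zeta> < \<bar>\<epsilon> i\<bar>}) - card Z * normal_tail \<zeta>\<bar>} \<union>
    {\<epsilon>\<in>space (noise n). n / (8 * \<zeta>) \<le> \<bar>(\<Sum>i\<in>Z. capped_score w_upper \<zeta> (\<epsilon> i)) -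
      card Z * (LINT x|std_normal_distribution. capped_score w_upper \<zeta> x)\<bar>}"

lemma capped_score_bounded: "\<bar>capped_score w_upper \<zeta> x\<bar> \<le> likelihood_ratio \<zeta> + 1 + 1 / w_upper"
proof (cases "\<bar>x\<bar> \<le> \<zeta>")
  case True
  then have "\<bar>likelihood_ratio x - 1\<bar> \<le> likelihood_ratio \<zeta> + 1"
    using likelihood_ratio_pos[of x] likelihood_ratio_mono[of x \<zeta>] by simp
  moreover have "0 \<le> 1 / w_upper"
    using w_upper by simp
  ultimately have "\<bar>likelihood_ratio x - 1\<bar> \<le> likelihood_ratio \<zeta> + 1 + 1 / w_upper"
    by linarith
  then show ?thesis
    using True by (simp add: capped_score_def)
next
  case False
  then show ?thesis
    using w_upper likelihood_ratio_pos[of \<zeta>] by (simp add: capped_score_def)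
qed

lemma bad_measurable: "bad \<in> sets (noise n)"
  unfolding bad_def using SZ level sizes
  by (intro sets.Un chebyshev_exceedances(2)
      chebyshev_noise(2)[OF capped_score_measurable capped_score_bounded _ _ order_refl]) auto

lemma prob_bad: "measure (noise n) bad \<le> failure_bound"
proof -
  interpret P: prob_space "noise n"
    by (rule prob_space_noise)
  have le: "measure (noise n) (A \<union> B) \<le> a + b"
    if "A \<in> sets (noise n)" "B \<in> sets (noise n)" "measure (noise n) A \<le> a" "measure (noise n) B \<le> b" for A B a b
    using measure_Un_le[OF that(1,2)] that(3,4) by linarith
  have cheb: "card I * p / (d * s)\<^sup>2 \<le> C / d\<^sup>2 / s"
    if "card I * p \<le> C * s" "0 < d" for I :: "nat set" and p C d :: real
  proof -
    have "card I * p / (d * s)\<^sup>2 \<le> C * s / (d * s)\<^sup>2"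
      using that by (intro divide_right_mono) auto
    also have "\<dots> = C / d\<^sup>2 / s"
      using that sizes by (simp add: power2_eq_square field_simps)
    finally show ?thesis .
  qed
  have "card S * normal_tail u \<le> 1 * real s"
    using SZ normal_tail_le_1[of u] sizes by (simp add: mult_le_cancel_left1)
  from cheb[OF this, of "\<delta> / 2"] have e1: "card S * normal_tail u / (\<delta> * s / 2)\<^sup>2 \<le> 4 / \<delta>\<^sup>2 / s"
    using level by (simp add: power2_eq_square)
  have Zn: "real (card Z) * q \<le> real n * q" if "0 \<le> q" for q
    using that SZ by (intro mult_right_mono) auto
  have e2: "card Z * normal_tail z1 / (\<delta> * s)\<^sup>2 \<le> c1 / \<delta>\<^sup>2 / s"
    using Zn[of "normal_tail z1"] level sizes normal_tail_nonneg[of z1]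
    by (intro cheb) (auto simp: normal_tail_z)
  have e3: "card Z * normal_tail z2 / (\<delta> * s)\<^sup>2 \<le> c2 / \<delta>\<^sup>2 / s"
    using Zn[of "normal_tail z2"] level sizes normal_tail_nonneg[of z2]
    by (intro cheb) (auto simp: normal_tail_z)
  have "card Z * normal_tail \<zeta> \<le> real n * (real s / real n / \<zeta>)"
    using Zn[of "normal_tail \<zeta>"] normal_tail_nonneg[of \<zeta>] normal_tail_threshold sizes
    by (smt (verit) mult_left_mono)
  also have "\<dots> \<le> 1 * real s"
    using sizes \<zeta> by (simp add: divide_le_eq mult_le_cancel_left1)
  finally have "card Z * normal_tail \<zeta> \<le> 1 * real s" .
  from cheb[OF this, of "\<delta> / 2"] have e4: "card Z * normal_tail \<zeta> / (\<delta> * s / 2)\<^sup>2 \<le> 4 / \<delta>\<^sup>2 / s"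
    using level by (simp add: power2_eq_square)
  have "card Z * (2 * (real n / (real s * \<zeta>\<^sup>2))) / (n / (8 * \<zeta>))\<^sup>2 \<le>
      n * (2 * (real n / (real s * \<zeta>\<^sup>2))) / (n / (8 * \<zeta>))\<^sup>2"
    using Zn[of "2 * (real n / (real s * \<zeta>\<^sup>2))"] by (intro divide_right_mono) auto
  also have "\<dots> = 128 / s"
    using sizes by (simp add: field_simps power2_eq_square)
  finally have e5: "card Z * (2 * (real n / (real s * \<zeta>\<^sup>2))) / (n / (8 * \<zeta>))\<^sup>2 \<le> 128 / s" .
  have pos: "0 < \<delta> * s / 2" "0 < \<delta> * s" "0 < n / (8 * \<zeta>)"
    using level sizes by auto
  note cap = chebyshev_noise[OF capped_score_measurable capped_score_bounded SZ(2) pos(3)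
      integral_capped_score_square_le]
  have "measure (noise n) bad \<le> 4 / \<delta>\<^sup>2 / s + c1 / \<delta>\<^sup>2 / s + c2 / \<delta>\<^sup>2 / s + 4 / \<delta>\<^sup>2 / s + 128 / s"
    unfolding bad_def
    by (intro le sets.Un chebyshev_exceedances(2) SZ pos cap(2)
        order_trans[OF chebyshev_exceedances(1) e1] order_trans[OF chebyshev_exceedances(1) e2]
        order_trans[OF chebyshev_exceedances(1) e3] order_trans[OF chebyshev_exceedances(1) e4]
        order_trans[OF cap(1) e5])
  also have "\<dots> = failure_bound"
    by (simp add: failure_bound_def add_divide_distrib)
  finally show ?thesis .
qed

lemma errors_off_bad:
  assumes \<epsilon>: "\<epsilon> \<in> space (noise n)" "\<epsilon> \<notin> bad"
  defines "X \<equiv> \<lambda>i\<in>{1..n}. \<theta> i + \<epsilon> i"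
  shows "\<bar>FDP n (cumulative_ell n t X) \<theta> - t\<bar> \<le> \<eta>"
    and "(\<Sum>i\<in>{1..n}. of_bool (\<theta> i \<noteq> 0 \<and> \<not> cumulative_ell n t X i)) /
      max 1 (\<Sum>i\<in>{1..n}. of_bool (\<theta> i \<noteq> 0)) \<le> \<delta>"
proof -
  let ?r = "real s / real n"
  have X: "X i = \<theta> i + \<epsilon> i" if "i \<in> {1..n}" for i
    using that by (simp add: X_def)
  have XZ: "X i = \<epsilon> i" if "i \<in> Z" for i
    using that X by (auto simp: Z_def)
  have finS: "finite S"
    using SZ finite_subset by blast
  \<comment> \<open>Signals with moderate noise. As they exceed \<zeta> + 2u before noise, they are
    still at least \<zeta> + u after it.\<close>
  define G where "G = {i\<in>S. \<bar>\<epsilon> i\<bar> \<le> u}"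
  have G: "G \<subseteq> S" "finite G"
    using finS by (auto simp: G_def)
  have "\<bar>real (card {i\<in>S. u < \<bar>\<epsilon> i\<bar>}) - card S * normal_tail u\<bar> < \<delta> * s / 2"
    using \<epsilon> by (auto simp: bad_def)
  moreover have "s * normal_tail u \<le> s * (\<delta> / 2)"
    using u by (intro mult_left_mono) auto
  ultimately have "real (card {i\<in>S. u < \<bar>\<epsilon> i\<bar>}) \<le> \<delta> * s"
    unfolding SZ(3) abs_less_iff by (simp add: algebra_simps)
  moreover have "card S = card {i\<in>S. u < \<bar>\<epsilon> i\<bar>} + card G"
    unfolding G_def using finS by (subst card_Un_disjoint[symmetric]) (auto intro: arg_cong[where f = card])
  ultimately have cardG: "(1 - \<delta>) * s \<le> card G"
    using SZ(3) by (simp add: algebra_simps)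
  have XG: "\<zeta> + u \<le> \<bar>X i\<bar>" if "i \<in> G" for i
  proof -
    have i: "i \<in> {1..n}" "\<theta> i \<noteq> 0" "\<bar>\<epsilon> i\<bar> \<le> u"
      using that by (auto simp: G_def S_def)
    then have "\<zeta> + v \<le> \<bar>\<theta> i\<bar>"
      using \<theta> by (auto simp: signal_class_def threshold_eq)
    then show ?thesis
      using i v X[OF i(1)] by linarith
  qed
  have lrG: "4 / \<delta> * (n / s) \<le> likelihood_ratio (X i) - 1" if "i \<in> G" for i
    using strong likelihood_ratio_mono[of "\<zeta> + u" "X i"] XG[OF that] u sizes by auto

  define w where "w = w_hat n X"
  have w_ge: "real s / (4 * real n) \<le> w"
    unfolding w_def
  proof (rule w_hat_ge_of_strong_signals)
    show "4 \<le> s" "s \<le> n" "G \<subseteq> {1..n}"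
      using sparsity G SZ by auto
    have "1 / 2 * real s \<le> (1 - \<delta>) * s"
      using sizes by (intro mult_right_mono) auto
    then show "real s \<le> 2 * card G"
      using cardG by simp
    have "1 \<le> 1 / \<delta>"
      using sizes level by simp
    then have "1 * (4 * (real n / real s)) \<le> 1 / \<delta> * (4 * (real n / real s))"
      using sizes by (intro mult_right_mono) auto
    then show "4 * real n / real s \<le> likelihood_ratio (X i) - 1" if "i \<in> G" for i
      using lrG[OF that] by simp
  qed
  \<comment> \<open>In units of n/\<zeta>: the signals add at most 1/4, the fluctuation less than
    1/8, and the null mean is below -3/8, which is the constant in
    \<open>score_bound\<close>.\<close>
  have score: "score n X w_upper < 0"
  proof -
    define m where "m = (LINT x|std_normal_distribution. capped_score w_upper \<zeta> x)"
    have "score n X w_upper \<le> real (card ({1..n} - Z)) / w_upper + (\<Sum>i\<in>Z. capped_score w_upper \<zeta> (X i))"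
      using w_upper SZ by (intro score_le_capped) auto
    also have "(\<Sum>i\<in>Z. capped_score w_upper \<zeta> (X i)) = (\<Sum>i\<in>Z. capped_score w_upper \<zeta> (\<epsilon> i))"
      using XZ by (intro sum.cong) auto
    also have "\<dots> < card Z * m + n / (8 * \<zeta>)"
      using \<epsilon> by (auto simp: bad_def m_def abs_le_iff)
    also have "card Z * m \<le> card Z * (- (2 / 3 * (1 - ?r) - 1 / (4 * \<zeta>)) / \<zeta>)"
      unfolding m_def by (intro mult_left_mono integral_capped_score_le) simp
    also have "\<dots> = - (n / \<zeta>) * ((1 - ?r) * (2 / 3 * (1 - ?r) - 1 / (4 * \<zeta>)))"
      unfolding SZ(4) using sizes by (simp add: field_simps)
    also have "\<dots> < - (n / \<zeta>) * (3 / 8)"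
      using score_bound sizes by (intro mult_strict_left_mono_neg) auto
    also have "real (card ({1..n} - Z)) / w_upper = n / \<zeta> * (1 / 4)"
      unfolding SZ(3,5) using sizes by (simp add: w_upper_def field_simps)
    finally show ?thesis
      using sizes by (simp add: field_simps)
  qed
  then have w_le: "w \<le> w_upper"
    unfolding w_def using w_upper sizes score_nonzeroD[of n X w_upper] by (intro w_hat_le) auto
  have w0: "0 < real s / (4 * real n)" "w < 1"
    using sizes w_le w_upper by auto
  have ellG: "ell_value w (X i) \<le> \<delta>" if "i \<in> G" for i
  proof -
    let ?w0 = "real s / (4 * real n)"
    \<comment> \<open>The factor 4 in \<open>strong\<close> cancels the 4 in the lower bound s/(4n)
      on the weight, so the denominator of the l-value is at least 1/\<delta>.\<close>
    have "?w0 * (4 / \<delta> * (n / s)) \<le> ?w0 * (likelihood_ratio (X i) - 1)"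
      using lrG[OF that] w0 by (intro mult_left_mono) auto
    then have le: "1 / \<delta> \<le> ?w0 * (likelihood_ratio (X i) - 1)"
      using sizes by simp
    have "ell_value w (X i) \<le> ell_value ?w0 (X i)"
      using w_ge w0 by (intro ell_value_antimono_weight) auto
    also have "\<dots> \<le> 1 / (1 / \<delta>)"
      unfolding ell_value_eq using le w0 w_ge level by (intro frac_le) auto
    finally show ?thesis
      by simp
  qed
  have ell_null: "1 - \<delta> \<le> ell_value w x" if "\<bar>x\<bar> \<le> \<zeta>" for x
  proof -
    \<comment> \<open>The extra \<zeta> in the weight is absorbed by the \<zeta>^2 in rho(\<zeta>).
      Monotonicity then carries the bound to all smaller |x| and smaller weights.\<close>
    have "w_upper * (likelihood_ratio \<zeta> - 1) \<le> w_upper * (real n / real s / \<zeta>\<^sup>2)"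
      unfolding likelihood_ratio_threshold using w_upper sizes
      by (intro mult_left_mono) (auto simp: field_simps)
    also have "\<dots> = 4 / \<zeta>"
      using sizes by (simp add: w_upper_def field_simps power2_eq_square)
    finally have "(1 - w_upper) / (1 + 4 / \<zeta>) \<le> ell_value w_upper \<zeta>"
      unfolding ell_value_eq using w_upper mixture_pos[of w_upper \<zeta>] by (intro divide_left_mono) (auto intro!: mult_pos_pos add_pos_pos simp: sizes)
    also have "\<dots> \<le> ell_value w_upper x"
      using w_upper that by (intro ell_value_antimono) auto
    also have "\<dots> \<le> ell_value w x"
      using w_le w0 w_ge w_upper by (intro ell_value_antimono_weight) auto
    finally show ?thesis
      using null by (simp add: w_upper_def)
  qed

  define N where "N = (\<lambda>z. real (card {i\<in>{1..n}. \<theta> i = 0 \<and> z < \<bar>X i\<bar>}))"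
  have N: "N z = real (card {i\<in>Z. z < \<bar>\<epsilon> i\<bar>})" for z
  proof -
    have "{i\<in>{1..n}. \<theta> i = 0 \<and> z < \<bar>X i\<bar>} = {i\<in>Z. z < \<bar>\<epsilon> i\<bar>}"
      using XZ by (auto simp: Z_def)
    then show ?thesis
      by (simp add: N_def)
  qed
  have mean: "c' * s - \<delta> * s \<le> card Z * (c' * ?r)" "card Z * (c' * ?r) \<le> c' * s" if "0 \<le> c'" "c' \<le> c2" for c' :: real
  proof -
    \<comment> \<open>There are n - s nulls rather than n, which loses c' s^2/n <= \<delta> s. With
      the fluctuation this explains 2 \<delta> in the lower and \<delta> in the upper count
      bounds.\<close>
    have "card Z * (c' * ?r) = c' * s - c' * ?r * s"
      unfolding SZ(4) using sizes by (simp add: field_simps)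
    moreover have "c' * ?r * s \<le> \<delta> * s"
      using that c sizes mult_right_mono[of c' c2 ?r] by (intro mult_right_mono) auto
    moreover have "0 \<le> c' * ?r * s"
      using that by simp
    ultimately show "c' * s - \<delta> * s \<le> card Z * (c' * ?r)" "card Z * (c' * ?r) \<le> c' * s"
      by auto
  qed
  have "\<bar>N z1 - card Z * (c1 * ?r)\<bar> < \<delta> * s"
    unfolding N normal_tail_z[symmetric] using \<epsilon> by (auto simp: bad_def)
  with mean[of c1] c have N1: "(c1 - 2 * \<delta>) * s \<le> N z1" "N z1 \<le> (c1 + \<delta>) * s"
    by (auto simp: algebra_simps abs_less_iff)
  have "\<bar>N z2 - card Z * (c2 * ?r)\<bar> < \<delta> * s"
    unfolding N normal_tail_z[symmetric] using \<epsilon> by (auto simp: bad_def)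
  with mean[of c2] c have N2: "(c2 - 2 * \<delta>) * s \<le> N z2" "N z2 \<le> (c2 + \<delta>) * s"
    by (auto simp: algebra_simps abs_less_iff)
  have "\<bar>N \<zeta> - card Z * normal_tail \<zeta>\<bar> < \<delta> * s / 2"
    unfolding N using \<epsilon> by (auto simp: bad_def)
  moreover have "card Z * normal_tail \<zeta> \<le> \<delta> * s / 2"
  proof -
    have "card Z * normal_tail \<zeta> \<le> n * (?r / \<zeta>)"
      using SZ normal_tail_threshold normal_tail_nonneg by (intro mult_mono) auto
    also have "\<dots> = 2 / \<zeta> * (s / 2)"
      using sizes by simp
    also have "\<dots> \<le> \<delta> * (s / 2)"
      using null by (intro mult_right_mono) auto
    finally show ?thesis
      by simp
  qed
  ultimately have N3: "N \<zeta> \<le> \<delta> * s"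
    unfolding abs_less_iff by linarith
  have XG': "z1 < \<bar>X i\<bar>" if "i \<in> G" for i
    using XG[OF that] z1_less u by linarith
  note sandwich = threshold_sandwich[of n s t \<delta> X \<theta> G z1 "c1 - 2 * \<delta>" "c1 + \<delta>" "c2 - 2 * \<delta>" z2 "c2 + \<delta>" \<zeta>,
      folded w_def S_def, OF sizes(3,4) level(1-5) w0(2) SZ(3) G(1) cardG XG' ellG
      N1[unfolded N_def] N2[unfolded N_def] N3[unfolded N_def] ell_null
      above(1) below(1)]
  show "(\<Sum>i\<in>{1..n}. of_bool (\<theta> i \<noteq> 0 \<and> \<not> cumulative_ell n t X i)) /
      max 1 (\<Sum>i\<in>{1..n}. of_bool (\<theta> i \<noteq> 0)) \<le> \<delta>"
    by (rule sandwich(3)) (use c level in auto)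
  have "(c1 - 2 * \<delta>) / (c1 - 2 * \<delta> + 1) \<le> FDP n (cumulative_ell n t X) \<theta>"
    by (rule sandwich(1)) (use c level in auto)
  moreover have "FDP n (cumulative_ell n t X) \<theta> \<le> (c2 + \<delta>) / (c2 + \<delta> + 1 - \<delta>)"
    by (rule sandwich(2)) (use c level in auto)
  ultimately show "\<bar>FDP n (cumulative_ell n t X) \<theta> - t\<bar> \<le> \<eta>"
    using above(2) below(2) by (simp add: abs_le_iff)
qed

lemma FDP_range: "0 \<le> FDP n d \<theta>'" "FDP n d \<theta>' \<le> 1"
proof -
  have "card {i\<in>{1..n}. \<theta>' i = 0 \<and> d i} \<le> card {i\<in>{1..n}. d i}"
    by (intro card_mono) auto
  then show "0 \<le> FDP n d \<theta>'" "FDP n d \<theta>' \<le> 1"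
    by (auto simp: FDP_eq divide_le_eq le_max_iff_disj)
qed

lemma FDR_close: "\<bar>FDR n (cumulative_ell n t) \<theta> - t\<bar> \<le> \<eta> + failure_bound"
proof -
  interpret P: prob_space "noise n"
    by (rule prob_space_noise)
  let ?X = "\<lambda>\<epsilon>. \<lambda>i\<in>{1..n}. \<theta> i + \<epsilon> i"
  let ?F = "\<lambda>\<epsilon>. FDP n (cumulative_ell n t (?X \<epsilon>)) \<theta>"
  have meas: "(\<lambda>X. FDP n (cumulative_ell n t X) \<theta>) \<in> borel_measurable (\<Pi>\<^sub>M i\<in>{1..n}. borel)"
    using sizes level by (intro FDP_measurable) auto
  have F_meas: "?F \<in> borel_measurable (noise n)"
    by (rule measurable_compose[OF measurable_shift meas])
  have F_int: "integrable (noise n) ?F"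
    by (rule P.integrable_const_bound[where B = 1]) (use FDP_range F_meas in auto)
  have "FDR n (cumulative_ell n t) \<theta> = P.expectation ?F"
    unfolding FDR_def by (rule integral_law[OF meas])
  then have "FDR n (cumulative_ell n t) \<theta> - t = P.expectation (\<lambda>\<epsilon>. ?F \<epsilon> - t)"
    using F_int by (simp add: P.prob_space)
  also have "\<bar>\<dots>\<bar> \<le> \<eta> + P.prob bad"
  proof (rule P.abs_expectation_le_off_event)
    show "(\<lambda>\<epsilon>. ?F \<epsilon> - t) \<in> borel_measurable (noise n)"
      using F_meas by simp
    show "\<bar>?F \<epsilon> - t\<bar> \<le> 1" for \<epsilon>
      using FDP_range[of "cumulative_ell n t (?X \<epsilon>)" \<theta>] level by (simp add: abs_le_iff)
  qed (use bad_measurable errors_off_bad(1) level in auto)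
  finally show ?thesis
    using prob_bad by simp
qed

lemma FNR_small: "0 \<le> FNR n (cumulative_ell n t) \<theta>" "FNR n (cumulative_ell n t) \<theta> \<le> \<delta> + failure_bound"
proof -
  interpret P: prob_space "noise n"
    by (rule prob_space_noise)
  let ?X = "\<lambda>\<epsilon>. \<lambda>i\<in>{1..n}. \<theta> i + \<epsilon> i"
  let ?H = "\<lambda>X. (\<Sum>i\<in>{1..n}. of_bool (\<theta> i \<noteq> 0 \<and> \<not> cumulative_ell n t X i)) /
      max 1 (\<Sum>i\<in>{1..n}. of_bool (\<theta> i \<noteq> 0)) :: real"
  have nonneg: "0 \<le> ?H X" for X
    by (intro divide_nonneg_nonneg sum_nonneg) auto
  have "(\<Sum>i\<in>{1..n}. of_bool (\<theta> i \<noteq> 0 \<and> \<not> cumulative_ell n t X i)) \<le> (\<Sum>i\<in>{1..n}. of_bool (\<theta> i \<noteq> 0) :: real)" for X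
    by (intro sum_mono) auto
  then have le_1: "?H X \<le> 1" for X
    by (subst divide_le_eq_1_pos) (auto intro: max.coboundedI2)
  show "0 \<le> FNR n (cumulative_ell n t) \<theta>"
    unfolding FNR_def using nonneg by (intro integral_nonneg_AE AE_I2)
  have meas: "?H \<in> borel_measurable (\<Pi>\<^sub>M i\<in>{1..n}. borel)"
    using sizes level by (intro FNP_measurable) auto
  have H_meas: "(\<lambda>\<epsilon>. ?H (?X \<epsilon>)) \<in> borel_measurable (noise n)"
    by (rule measurable_compose[OF measurable_shift meas])
  have "FNR n (cumulative_ell n t) \<theta> = P.expectation (\<lambda>\<epsilon>. ?H (?X \<epsilon>))"
    unfolding FNR_def by (rule integral_law[OF meas])
  also have "\<dots> \<le> \<bar>P.expectation (\<lambda>\<epsilon>. ?H (?X \<epsilon>))\<bar>"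
    by simp
  also have "\<dots> \<le> \<delta> + P.prob bad"
  proof (rule P.abs_expectation_le_off_event)
    show "\<bar>?H (?X \<epsilon>)\<bar> \<le> 1" for \<epsilon>
      using nonneg le_1 by (simp only: abs_of_nonneg)
    show "\<bar>?H (?X \<epsilon>)\<bar> \<le> \<delta>" if "\<epsilon> \<in> space (noise n)" "\<epsilon> \<notin> bad" for \<epsilon>
      using nonneg errors_off_bad(2)[OF that] by (simp only: abs_of_nonneg)
    show "0 \<le> \<delta>"
      using level by simp
  qed (rule H_meas bad_measurable)+
  finally show "FNR n (cumulative_ell n t) \<theta> \<le> \<delta> + failure_bound"
    using prob_bad by simp
qed

end

end

section \<open>Asymptotics\<close>

text \<open>At c = t/(1 - t) false rejections per signal the false discovery proportion is t. The
  shift \<kappa> is chosen before \<delta>: it turns the equalities at c into strict inequalities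
  for c1 and c2, and these survive a small \<delta> by continuity.\<close>

lemma regime_constants_exist:
  fixes t \<eta> :: real
  assumes "0 < t" "t < 1" "0 < \<eta>"
  obtains c1 c2 \<delta> where "0 < c1" "c1 \<le> c2" "0 < \<delta>" "\<delta> \<le> t" "\<delta> + t \<le> 1" "\<delta> \<le> \<eta>" "2 * \<delta> \<le> c1"
    "\<delta> + t < (1 - \<delta> - t) * (c2 - 2 * \<delta>)" "(c2 + \<delta>) / (c2 + \<delta> + 1 - \<delta>) \<le> t + \<eta>"
    "(1 - t) * (c1 + \<delta>) + (1 - \<delta>) * (\<delta> - t) + \<delta> \<le> 0" "t - \<eta> \<le> (c1 - 2 * \<delta>) / (c1 - 2 * \<delta> + 1)"
proof -
  define c where "c = t / (1 - t)"
  have c: "0 < c" "c / (c + 1) = t" "(1 - t) * c = t"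
    using assms by (auto simp: c_def field_simps)
  have "((\<lambda>\<kappa>. (c + \<kappa>) / (c + \<kappa> + 1)) \<longlongrightarrow> (c + 0) / (c + 0 + 1)) (at_right 0)"
    using c by (intro tendsto_intros) auto
  then have 1: "eventually (\<lambda>\<kappa>. (c + \<kappa>) / (c + \<kappa> + 1) < t + \<eta>) (at_right 0)"
    by (rule order_tendstoD(2)) (use c assms in auto)
  have "((\<lambda>\<kappa>. (c - \<kappa>) / (c - \<kappa> + 1)) \<longlongrightarrow> (c - 0) / (c - 0 + 1)) (at_right 0)"
    using c by (intro tendsto_intros) auto
  then have 2: "eventually (\<lambda>\<kappa>. t - \<eta> < (c - \<kappa>) / (c - \<kappa> + 1)) (at_right 0)"
    by (rule order_tendstoD(1)) (use c assms in auto)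
  have 3: "eventually (\<lambda>\<kappa>. \<kappa> \<in> {0<..<c}) (at_right 0)"
    using c by (intro eventually_at_right_real)
  from eventually_happens'[OF _ eventually_conj[OF 1 eventually_conj[OF 2 3]]]
  obtain \<kappa> where \<kappa>: "(c + \<kappa>) / (c + \<kappa> + 1) < t + \<eta>" "t - \<eta> < (c - \<kappa>) / (c - \<kappa> + 1)" "0 < \<kappa>" "\<kappa> < c"
    by auto
  define c1 c2 where "c1 = c - \<kappa>" and "c2 = c + \<kappa>"
  have c12: "0 < c1" "c1 \<le> c2" "(1 - t) * c1 < t" "t < (1 - t) * c2"
    using \<kappa> c mult_pos_pos[of "1 - t" \<kappa>] assms by (auto simp: c1_def c2_def distrib_left right_diff_distrib)
  have "((\<lambda>\<delta>. (1 - \<delta> - t) * (c2 - 2 * \<delta>) - (\<delta> + t)) \<longlongrightarrow> (1 - 0 - t) * (c2 - 2 * 0) - (0 + t)) (at_right 0)"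
    by (intro tendsto_intros)
  then have 1: "eventually (\<lambda>\<delta>. 0 < (1 - \<delta> - t) * (c2 - 2 * \<delta>) - (\<delta> + t)) (at_right 0)"
    by (rule order_tendstoD(1)) (use c12 in auto)
  have "((\<lambda>\<delta>. (c2 + \<delta>) / (c2 + \<delta> + 1 - \<delta>)) \<longlongrightarrow> (c2 + 0) / (c2 + 0 + 1 - 0)) (at_right 0)"
    using c12 by (intro tendsto_intros) auto
  then have 2: "eventually (\<lambda>\<delta>. (c2 + \<delta>) / (c2 + \<delta> + 1 - \<delta>) < t + \<eta>) (at_right 0)"
    by (rule order_tendstoD(2)) (use \<kappa> in \<open>auto simp: c2_def\<close>)
  have "((\<lambda>\<delta>. (1 - t) * (c1 + \<delta>) + (1 - \<delta>) * (\<delta> - t) + \<delta>) \<longlongrightarrow> (1 - t) * (c1 + 0) + (1 - 0) * (0 - t) + 0) (at_right 0)"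
    by (intro tendsto_intros)
  then have 3: "eventually (\<lambda>\<delta>. (1 - t) * (c1 + \<delta>) + (1 - \<delta>) * (\<delta> - t) + \<delta> < 0) (at_right 0)"
    by (rule order_tendstoD(2)) (use c12 in auto)
  have "((\<lambda>\<delta>. (c1 - 2 * \<delta>) / (c1 - 2 * \<delta> + 1)) \<longlongrightarrow> (c1 - 2 * 0) / (c1 - 2 * 0 + 1)) (at_right 0)"
    using c12 by (intro tendsto_intros) auto
  then have 4: "eventually (\<lambda>\<delta>. t - \<eta> < (c1 - 2 * \<delta>) / (c1 - 2 * \<delta> + 1)) (at_right 0)"
    by (rule order_tendstoD(1)) (use \<kappa> in \<open>auto simp: c1_def\<close>)
  have 5: "eventually (\<lambda>\<delta>. \<delta> \<in> {0<..<min (min t (1 - t)) (min \<eta> (c1 / 2))}) (at_right 0)"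
    using c12 assms by (intro eventually_at_right_real) auto
  from eventually_happens'[OF _ eventually_conj[OF 1 eventually_conj[OF 2 eventually_conj[OF 3 eventually_conj[OF 4 5]]]]]
  obtain \<delta> where "0 < (1 - \<delta> - t) * (c2 - 2 * \<delta>) - (\<delta> + t)" "(c2 + \<delta>) / (c2 + \<delta> + 1 - \<delta>) < t + \<eta>"
    "(1 - t) * (c1 + \<delta>) + (1 - \<delta>) * (\<delta> - t) + \<delta> < 0" "t - \<eta> < (c1 - 2 * \<delta>) / (c1 - 2 * \<delta> + 1)"
    "\<delta> \<in> {0<..<min (min t (1 - t)) (min \<eta> (c1 / 2))}"
    by auto
  then show ?thesis
    using c12 by (intro that[of c1 c2 \<delta>]) auto
qed

text \<open>For \<zeta>, u >= 2 and y = \<zeta> + u one has y^2/2 >= \<zeta>^2/2 + y. So exp(y^2/2)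
  gains a factor e^y over r, which outweighs the y^2 in the denominator of rho.\<close>

lemma likelihood_ratio_beyond_threshold:
  fixes r K u \<zeta> :: real
  assumes "1 \<le> r" "exp (\<zeta>\<^sup>2 / 2) = r" "2 \<le> \<zeta>" "2 \<le> u"
    and "K \<le> (exp (\<zeta> + u) - 1) / (\<zeta> + u)\<^sup>2 - 1"
  shows "K * r \<le> likelihood_ratio (\<zeta> + u) - 1"
proof -
  define y where "y = \<zeta> + u"
  have y: "0 < y\<^sup>2" "y \<noteq> 0"
    using assms by (auto simp: y_def)
  have "0 \<le> (\<zeta> - 1) * (u - 1) - 1 + u\<^sup>2 / 2"
    using mult_mono[of 1 "\<zeta> - 1" 1 "u - 1"] assms by auto
  then have "\<zeta>\<^sup>2 / 2 + y \<le> y\<^sup>2 / 2"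
    by (simp add: y_def power2_eq_square field_simps)
  then have "r * exp y \<le> exp (y\<^sup>2 / 2)"
    by (simp flip: assms(2) exp_add)
  moreover have "r * (exp y - 1) \<le> r * exp y - 1"
    using assms by (simp add: algebra_simps)
  ultimately have "r * (exp y - 1) / y\<^sup>2 \<le> likelihood_ratio y"
    unfolding likelihood_ratio_eq[OF y(2)] using y by (intro divide_right_mono) auto
  moreover have "r * K \<le> r * ((exp y - 1) / y\<^sup>2 - 1)"
    using assms by (intro mult_left_mono) (auto simp: y_def)
  ultimately show ?thesis
    using assms by (simp add: y_def algebra_simps)
qed

lemma eventually_sparse_regime:
  fixes s :: "nat \<Rightarrow> nat" and v :: "nat \<Rightarrow> real"
  assumes s: "filterlim s at_top sequentially" "(\<lambda>n. real (s n) / real n) \<longlonglongrightarrow> 0"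
    and v: "filterlim v at_top sequentially"
    and level: "0 < t" "t < 1" "0 < \<delta>" "\<delta> \<le> t" "\<delta> + t \<le> 1" "\<delta> \<le> \<eta>"
    and c: "0 < c1" "c1 \<le> c2" "2 * \<delta> \<le> c1"
    and above: "\<delta> + t < (1 - \<delta> - t) * (c2 - 2 * \<delta>)" "(c2 + \<delta>) / (c2 + \<delta> + 1 - \<delta>) \<le> t + \<eta>"
    and below: "(1 - t) * (c1 + \<delta>) + (1 - \<delta>) * (\<delta> - t) + \<delta> \<le> 0"
      "t - \<eta> \<le> (c1 - 2 * \<delta>) / (c1 - 2 * \<delta> + 1)"
  shows "eventually (\<lambda>n. sparse_regime n (s n) t \<delta> \<eta> c1 c2 (sqrt (2 * ln (real n / real (s n)))) (v n / 2))
    sequentially"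
proof -
  define r where "r = (\<lambda>n. real (s n) / real n)"
  define \<zeta> where "\<zeta> = (\<lambda>n. sqrt (2 * ln (real n / real (s n))))"
  have s4: "eventually (\<lambda>n. 4 \<le> s n) sequentially"
    using s(1) by (simp add: filterlim_at_top)
  have r1: "eventually (\<lambda>n. r n < 1) sequentially"
    using s(2) unfolding r_def by (rule order_tendstoD) simp
  have small: "eventually (\<lambda>n. 4 \<le> s n \<and> s n < n) sequentially"
    using s4 r1 eventually_gt_at_top[of 0] by eventually_elim (auto simp: r_def)
  have r0: "eventually (\<lambda>n. 0 < r n) sequentially"
    using small by eventually_elim (auto simp: r_def)
  have "filterlim (\<lambda>n. inverse (r n)) at_top sequentially"
    using s(2) r0 unfolding r_def by (rule filterlim_inverse_at_top)
  then have ratio: "filterlim (\<lambda>n. real n / real (s n)) at_top sequentially"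
    by (simp add: r_def)
  have \<zeta>_lim: "filterlim \<zeta> at_top sequentially"
    unfolding \<zeta>_def
    by (intro filterlim_compose[OF sqrt_at_top] filterlim_tendsto_pos_mult_at_top[OF tendsto_const]
        filterlim_compose[OF ln_at_top ratio]) auto
  have u_lim: "filterlim (\<lambda>n. v n / 2) at_top sequentially"
    using filterlim_tendsto_pos_mult_at_top[OF tendsto_const _ v, of "1 / 2"] by simp
  have y_lim: "filterlim (\<lambda>n. \<zeta> n + v n / 2) at_top sequentially"
    by (rule filterlim_at_top_add_at_top[OF \<zeta>_lim u_lim])
  have \<zeta>_eq: "eventually (\<lambda>n. exp ((\<zeta> n)\<^sup>2 / 2) = real n / real (s n) \<and> r n = exp (- (\<zeta> n)\<^sup>2 / 2)) sequentially"
    using small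
  proof eventually_elim
    case (elim n)
    then have gt: "1 < real n / real (s n)"
      by simp
    then have "(\<zeta> n)\<^sup>2 = 2 * ln (real n / real (s n))"
      by (simp add: \<zeta>_def)
    then have 1: "exp ((\<zeta> n)\<^sup>2 / 2) = real n / real (s n)"
      using gt by simp
    have "exp (- (\<zeta> n)\<^sup>2 / 2) = inverse (exp ((\<zeta> n)\<^sup>2 / 2))"
      by (simp add: exp_minus[symmetric])
    then show ?case
      using 1 by (simp add: r_def)
  qed
  \<comment> \<open>Since s/n = exp(-\<zeta>^2/2), the conditions in s, n and \<zeta> become limits
    in the single real variable \<zeta>.\<close>
  have "((\<lambda>z::real. 4 * exp (- z\<^sup>2 / 2) * z) \<longlongrightarrow> 0) at_top"
    by real_asymp
  then have e1: "eventually (\<lambda>z::real. 4 * exp (- z\<^sup>2 / 2) * z < 1) at_top"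
    by (rule order_tendstoD) simp
  have "((\<lambda>z::real. (1 - 4 * exp (- z\<^sup>2 / 2) * z) / (1 + 4 / z)) \<longlongrightarrow> 1) at_top"
    by real_asymp
  then have e2: "eventually (\<lambda>z::real. 1 - \<delta> < (1 - 4 * exp (- z\<^sup>2 / 2) * z) / (1 + 4 / z)) at_top"
    by (rule order_tendstoD(1)) (use level in auto)
  have "((\<lambda>z::real. 2 / z) \<longlongrightarrow> 0) at_top"
    by real_asymp
  then have e3: "eventually (\<lambda>z::real. 2 / z < \<delta>) at_top"
    by (rule order_tendstoD(2)) (use level in auto)
  have "((\<lambda>z::real. exp (- z\<^sup>2 / 2) * z\<^sup>2) \<longlongrightarrow> 0) at_top"
    by real_asymp
  then have e4: "eventually (\<lambda>z::real. exp (- z\<^sup>2 / 2) * z\<^sup>2 < 1) at_top"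
    by (rule order_tendstoD) simp
  have "((\<lambda>z::real. (1 - exp (- z\<^sup>2 / 2)) * (2 / 3 * (1 - exp (- z\<^sup>2 / 2)) - 1 / (4 * z))) \<longlongrightarrow> 2 / 3) at_top"
    by real_asymp
  then have e5: "eventually (\<lambda>z::real. 3 / 8 < (1 - exp (- z\<^sup>2 / 2)) * (2 / 3 * (1 - exp (- z\<^sup>2 / 2)) - 1 / (4 * z))) at_top"
    by (rule order_tendstoD) simp
  have "((\<lambda>z::real. 1 / z) \<longlongrightarrow> 0) at_top"
    by real_asymp
  then have e6: "eventually (\<lambda>z::real. 1 / z < c1) at_top"
    by (rule order_tendstoD(2)) (use c in auto)
  have "((\<lambda>z::real. exp (- z\<^sup>2 / 2)) \<longlongrightarrow> 0) at_top"
    by real_asymp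
  then have "((\<lambda>z. c2 * exp (- z\<^sup>2 / 2)) \<longlongrightarrow> c2 * 0) at_top"
    by (rule tendsto_mult_left)
  then have e7: "eventually (\<lambda>z::real. c2 * exp (- z\<^sup>2 / 2) < \<delta>) at_top"
    by (rule order_tendstoD(2)) (use level in auto)
  have "filterlim (\<lambda>y::real. (exp y - 1) / y\<^sup>2 - 1) at_top at_top"
    by real_asymp
  then have e8: "eventually (\<lambda>y. 4 / \<delta> \<le> (exp y - 1) / y\<^sup>2 - 1) at_top"
    by (simp add: filterlim_at_top)
  have e9: "eventually (\<lambda>u. normal_tail u < \<delta> / 2) at_top"
    using level by (intro order_tendstoD(2)[OF normal_tail_tendsto_0]) auto
  note at_\<zeta> = eventually_compose_filterlim[OF _ \<zeta>_lim]
  note at_u = eventually_compose_filterlim[OF _ u_lim]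
  show ?thesis
    using small \<zeta>_eq at_\<zeta>[OF e1] at_\<zeta>[OF e2] at_\<zeta>[OF e3] at_\<zeta>[OF e4] at_\<zeta>[OF e5] at_\<zeta>[OF e6] at_\<zeta>[OF e7]
      at_\<zeta>[OF eventually_ge_at_top[of 2]] at_u[OF e9] at_u[OF eventually_ge_at_top[of 2]]
      eventually_compose_filterlim[OF e8 y_lim]
  proof eventually_elim
    case (elim n)
    have r: "real (s n) / real n = exp (- (\<zeta> n)\<^sup>2 / 2)"
      using elim by (simp add: r_def)
    have "4 / \<delta> * (real n / real (s n)) \<le> likelihood_ratio (\<zeta> n + v n / 2) - 1"
      using elim by (intro likelihood_ratio_beyond_threshold) auto
    moreover have "sqrt (2 * ln (real n / real (s n))) = \<zeta> n"
      by (simp add: \<zeta>_def)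
    ultimately show ?case
      by unfold_locales (use elim level c above below in \<open>simp_all add: r\<close>)
  qed
qed

text \<open>A real supremum over the empty set has an unspecified value, so the class must be
  inhabited before its suprema can be bounded.\<close>

lemma signal_class_nonempty:
  assumes "s \<le> n" "0 < sqrt (2 * ln (real n / real s)) + v"
  shows "signal_class n s v \<noteq> {}"
proof -
  define b where "b = sqrt (2 * ln (real n / real s)) + v"
  define \<theta> where "\<theta> = (\<lambda>i\<in>{1..n}. if i \<le> s then b else 0)"
  have "{i\<in>{1..n}. \<theta> i \<noteq> 0} = {1..s}"
    using assms by (auto simp: \<theta>_def b_def)
  then have "\<theta> \<in> signal_class n s v"
    using assms unfolding signal_class_def by (auto simp: \<theta>_def b_def[symmetric])
  then show ?thesis
    by auto
qed

lemma abs_cSUP_le: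
  fixes f :: "'a \<Rightarrow> real"
  assumes "A \<noteq> {}" "\<And>x. x \<in> A \<Longrightarrow> 0 \<le> f x" "\<And>x. x \<in> A \<Longrightarrow> f x \<le> B"
  shows "\<bar>SUP x\<in>A. f x\<bar> \<le> B"
proof -
  obtain x where x: "x \<in> A"
    using assms(1) by auto
  have "0 \<le> (SUP x\<in>A. f x)"
    using assms x by (intro cSUP_upper2[OF _ x]) (auto intro!: bdd_aboveI[of _ B])
  moreover have "(SUP x\<in>A. f x) \<le> B"
    using assms by (intro cSUP_least) auto
  ultimately show ?thesis
    by simp
qed

lemma eventually_error_rates:
  fixes t \<eta> :: real and s :: "nat \<Rightarrow> nat" and v :: "nat \<Rightarrow> real"
  assumes t: "0 < t" "t < 1"
    and s: "filterlim s at_top sequentially" "(\<lambda>n. real (s n) / real n) \<longlonglongrightarrow> 0"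
    and v: "filterlim v at_top sequentially"
    and "0 < \<eta>"
  shows "eventually (\<lambda>n. \<bar>SUP \<theta>\<in>signal_class n (s n) (v n). \<bar>FDR n (cumulative_ell n t) \<theta> - t\<bar>\<bar> \<le> 2 * \<eta> \<and>
    \<bar>SUP \<theta>\<in>signal_class n (s n) (v n). FNR n (cumulative_ell n t) \<theta>\<bar> \<le> 2 * \<eta>) sequentially"
proof -
  obtain c1 c2 \<delta> where const: "0 < c1" "c1 \<le> c2" "0 < \<delta>" "\<delta> \<le> t" "\<delta> + t \<le> 1" "\<delta> \<le> \<eta>" "2 * \<delta> \<le> c1"
    "\<delta> + t < (1 - \<delta> - t) * (c2 - 2 * \<delta>)" "(c2 + \<delta>) / (c2 + \<delta> + 1 - \<delta>) \<le> t + \<eta>"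
    "(1 - t) * (c1 + \<delta>) + (1 - \<delta>) * (\<delta> - t) + \<delta> \<le> 0" "t - \<eta> \<le> (c1 - 2 * \<delta>) / (c1 - 2 * \<delta> + 1)"
    using regime_constants_exist[OF t \<open>0 < \<eta>\<close>] by metis
  have regime: "eventually (\<lambda>n. sparse_regime n (s n) t \<delta> \<eta> c1 c2 (sqrt (2 * ln (real n / real (s n)))) (v n / 2))
      sequentially"
    by (rule eventually_sparse_regime) fact+
  \<comment> \<open>The numerator of \<open>failure_bound\<close>, constant in n.\<close>
  define Q where "Q = 8 / \<delta>\<^sup>2 + (c1 + c2) / \<delta>\<^sup>2 + 128"
  have "((\<lambda>n. Q / real (s n)) \<longlongrightarrow> 0) sequentially"
    by (intro tendsto_divide_0[OF tendsto_const] filterlim_at_top_imp_at_infinity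
        filterlim_compose[OF filterlim_real_sequentially s(1)])
  then have "eventually (\<lambda>n. Q / real (s n) < \<eta>) sequentially"
    using \<open>0 < \<eta>\<close> by (rule order_tendstoD)
  then show ?thesis
    using regime
  proof eventually_elim
    case (elim n)
    interpret sparse_regime n "s n" t \<delta> \<eta> c1 c2 "sqrt (2 * ln (real n / real (s n)))" "v n / 2"
      by fact
    have failure: "failure_bound < \<eta>"
      using elim by (simp add: failure_bound_def Q_def)
    have "0 < sqrt (2 * ln (real n / real (s n))) + v n"
      using \<zeta>(1) u(1) by linarith
    then have ne: "signal_class n (s n) (v n) \<noteq> {}"
      using sparsity by (intro signal_class_nonempty) auto
    show ?case
    proof
      show "\<bar>SUP \<theta>\<in>signal_class n (s n) (v n). \<bar>FDR n (cumulative_ell n t) \<theta> - t\<bar>\<bar> \<le> 2 * \<eta>"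
        using ne
      proof (rule abs_cSUP_le)
        fix \<theta> assume "\<theta> \<in> signal_class n (s n) (v n)"
        from FDR_close[OF this] show "\<bar>FDR n (cumulative_ell n t) \<theta> - t\<bar> \<le> 2 * \<eta>"
          using failure by simp
      qed simp
      show "\<bar>SUP \<theta>\<in>signal_class n (s n) (v n). FNR n (cumulative_ell n t) \<theta>\<bar> \<le> 2 * \<eta>"
        using ne
      proof (rule abs_cSUP_le)
        fix \<theta> assume "\<theta> \<in> signal_class n (s n) (v n)"
        from FNR_small[OF this] show "0 \<le> FNR n (cumulative_ell n t) \<theta>" "FNR n (cumulative_ell n t) \<theta> \<le> 2 * \<eta>"
          using failure const by simp_all
      qed
    qed
  qed
qed

theorem theorem1:
  fixes t :: real and s :: "nat \<Rightarrow> nat" and v :: "nat \<Rightarrow> real"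
  assumes "0 < t" and "t < 1"
    and "\<And>n. n \<ge> 1 \<Longrightarrow> s n \<ge> 1"
    and "filterlim s at_top sequentially"
    and "(\<lambda>n. real (s n) / real n) \<longlonglongrightarrow> 0"
    and "filterlim v at_top sequentially"
  shows "(\<lambda>n. SUP \<theta>\<in>signal_class n (s n) (v n). \<bar>FDR n (cumulative_ell n t) \<theta> - t\<bar>) \<longlonglongrightarrow> 0
       \<and> (\<lambda>n. SUP \<theta>\<in>signal_class n (s n) (v n). FNR n (cumulative_ell n t) \<theta>) \<longlonglongrightarrow> 0"
proof -
  have "eventually (\<lambda>n. \<bar>SUP \<theta>\<in>signal_class n (s n) (v n). \<bar>FDR n (cumulative_ell n t) \<theta> - t\<bar>\<bar> < e \<and>
      \<bar>SUP \<theta>\<in>signal_class n (s n) (v n). FNR n (cumulative_ell n t) \<theta>\<bar> < e) sequentially" if "0 < e" for e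
    using eventually_error_rates[OF assms(1,2,4-6), of "e / 3"] that by (auto elim!: eventually_mono)
  then show ?thesis
    unfolding tendsto_iff dist_real_def by (simp add: eventually_conj_iff)
qed

end
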